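(* Let $d\ge2$ be an integer and $(c_j)_{j\ge0}$ an integer sequence such that $f(z)=\sum_{j\ge0}c_jz^j$ converges inside the open unit disk. Suppose there exist polynomials $A(z),B(z),C(z),D(z)\in\mathbb{Z}[z]$ such that $$f(z)=\frac{A(z)}{B(z)}+\frac{C(z)}{D(z)}f(z^d).$$ Let $b\ge2$ be an integer such that $B(1/b^{d^m})C(1/b^{d^m})D(1/b^{d^m})\neq0$ for all integers $m\ge0$. If there exists an increasing sequence of positive integers $(n_i)_{i\ge0}$ such that $H_{n_i}(f)\neq0$ for all $i\ge0$ and $\limsup_{i\to\infty}n_{i+1}/n_i=\rho$ (a real number), then $f(1/b)$ is transcendental and $$\mu\bigl(f(1/b)\bigr)\le(1+\rho)\min\{\rho^2,d\}.$$ In particular, if $\rho=1$ then the irrationality exponent of $f(1/b)$ is equal to $2$.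
   Context: For a power series $f(z)=\sum_{j\ge0}c_jz^j$, its Hankel determinants are $H_0(f)=1$ and, for $n\ge1$, $H_n(f)=\det(c_{i+j})_{0\le i,j\le n-1}$. The irrationality exponent $\mu(\xi)$ of an irrational real number $\xi$ is the supremum of the real numbers $\mu$ such that $|\xi-p/q|<q^{-\mu}$ has infinitely many solutions in rational numbers $p/q$. *)

theory Defs
  imports Complex_Main "HOL-Computational_Algebra.Polynomial" "HOL-Library.Extended_Real"
    "HOL-Library.Liminf_Limsup" "Jordan_Normal_Form.Determinant"
begin

definition pser :: "(nat \<Rightarrow> int) \<Rightarrow> 'a::real_normed_field \<Rightarrow> 'a" where
  "pser c z = (\<Sum>j. of_int (c j) * z ^ j)"

definition hankel_det :: "(nat \<Rightarrow> int) \<Rightarrow> nat \<Rightarrow> int" where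
  "hankel_det c n = det (mat n n (\<lambda>(i, j). c (i + j)))"

definition irrationality_exponent :: "real \<Rightarrow> ereal" where
  "irrationality_exponent \<xi> =
     Sup (ereal ` {\<mu>. infinite {pq :: int \<times> int. let p = fst pq; q = snd pq in q > 0 \<and>
                          \<bar>\<xi> - real_of_int p / real_of_int q\<bar> < real_of_int q powr (- \<mu>)}})"

end

(*
A function satisfying the functional equation is evaluated at z_m = 1/b^(d^m): iterating the equation
gives S f(1/b) = U + T f(z_m) with nonzero integers S, T bounded by b^(K d^m), where K is independent of m.

Transcendence is Mahler's method.  An algebraic f would make some P f bounded on the disc (P the leading
coefficient of an algebraic relation); since its coefficients are integers, Parseval's identity makes P f a
polynomial, contradicting the nonvanishing Hankel determinants.  So a nontrivial polynomial E in z and f of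
degree N in both, vanishing at 0 to order N^2, is not identically zero; E(z_m) is a nonzero integer
polynomial in f(1/b), up to a controlled factor, too small for Liouville's inequality when f(1/b) is algebraic.

For the exponent, a Pade approximant Q f - P = z^e G with deg Q at most n_i and nonzero Hankel determinants at
n_i and n_(i+1) has 2 n_i <= e < n_i + n_(i+1).  At z_m this gives integers q, p with
q <= b^((n_i + K + 1) d^m) and |q f(1/b) - p| between b^(- n_(i+1) d^m) and b^(-(n_i - K - 1) d^m).
A finite range of indices i, combined with all large m, yields scales n_i d^m whose consecutive quotients are at most
rho + epsilon (or d, using a single i), which bounds the exponent by (1 + rho) min(rho, d).
*)
theory Submission
  imports "HOL-Analysis.Kronecker_Approximation_Theorem" Defs
    "HOL-Computational_Algebra.Polynomial_FPS"
begin

section \<open>Hankel determinants and Pade approximants\<close>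

text \<open>Two orders of quantifiers shape the proof. In the transcendence part the Liouville
  exponent \<open>s\<close> depends on the number alone and is fixed before the degree
  \<open>N\<close>, so that the gain N^2 from vanishing beats losses linear in \<open>N\<close>. All
  auxiliary polynomials are fixed before m tends to infinity, so the sizes of their coefficients are
  mere constants. In the exponent part, the m from which a Pade approximant is usable depends on its
  index i without any uniformity; this is why finitely many i must do, with powers of d repeating
  their scales. The upper limit on e gives a quantitative lower bound for the linear form q f - p.
  It settles the case in which a competing fraction coincides with p/q, while a distinct fraction is
  handled by a nonzero integer difference. With quotient theta between consecutive scales, the
  denominators contribute theta and the lower bound rho theta, whence (1 + rho) theta. The bound
  obtained has rho in the minimum; rho >= 1 then yields the one with rho^2.\<close>

lemma int_homogeneous_solution:
  fixes a :: "nat \<Rightarrow> nat \<Rightarrow> int"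
  assumes "r < k"
  shows "\<exists>x. (\<exists>j<k. x j \<noteq> 0) \<and> (\<forall>i<r. (\<Sum>j<k. a i j * x j) = 0)"
proof -
  \<comment> \<open>Zero rows pad the system to a singular square matrix; over the integral domain
    of integers its kernel vector is already integral.\<close>
  define M where "M = mat k k (\<lambda>(i, j). if i < r then a i j else 0)"
  have M: "M \<in> carrier_mat k k" by (simp add: M_def)
  have "det M = (\<Sum>j<k. M $$ (r, j) * cofactor M r j)"
    by (rule laplace_expansion_row[OF M assms])
  also have "\<dots> = 0" using assms by (intro sum.neutral) (auto simp: M_def)
  finally obtain v where v: "v \<in> carrier_vec k" "v \<noteq> 0\<^sub>v k" "M *\<^sub>v v = 0\<^sub>v k"
    using det_0_iff_vec_prod_zero[OF M] by auto
  have "\<exists>j<k. v $ j \<noteq> 0"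
    using v(1,2) by (auto simp: vec_eq_iff)
  moreover have "(\<Sum>j<k. a i j * v $ j) = 0" if "i < r" for i
  proof -
    have "(M *\<^sub>v v) $ i = 0" using v(3) that assms by simp
    then show ?thesis
      using that assms v(1) by (simp add: M_def scalar_prod_def lessThan_atLeast0)
  qed
  ultimately show ?thesis by blast
qed

lemma poly_with_coeffs:
  fixes x :: "nat \<Rightarrow> 'a::comm_monoid_add"
  shows "\<exists>Q. degree Q \<le> n \<and> (\<forall>j. coeff Q j = (if j \<le> n then x j else 0))"
proof -
  define Q where "Q = (\<Sum>i\<le>n. monom (x i) i)"
  have "coeff Q j = (if j \<le> n then x j else 0)" for j
    by (auto simp: Q_def coeff_sum)
  moreover from this have "degree Q \<le> n" by (intro degree_le) auto
  ultimately show ?thesis by blast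
qed

text \<open>The coefficients of \<open>P\<close> in reverse order form a kernel vector of the Hankel
  matrix: row \<open>i\<close> of the product is coefficient \<open>k + i\<close> of
  \<open>P\<close> times the series. The slack between \<open>degree P\<close> and \<open>k\<close>
  lets the window of zero coefficients start later than the degree.\<close>

lemma hankel_det_eq_0I:
  assumes "P \<noteq> 0" "degree P \<le> k" "k < n"
    and "\<And>i. i < n \<Longrightarrow> fps_nth (fps_of_poly P * Abs_fps c) (k + i) = 0"
  shows "hankel_det c n = 0"
proof -
  define M where "M = mat n n (\<lambda>(i, j). c (i + j))"
  define v where "v = vec n (\<lambda>j. if j \<le> k then coeff P (k - j) else 0)"
  have M: "M \<in> carrier_mat n n" by (simp add: M_def)
  have "(M *\<^sub>v v) $ i = 0" if i: "i < n" for i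
  proof -
    have "(M *\<^sub>v v) $ i = (\<Sum>j<n. c (i + j) * (if j \<le> k then coeff P (k - j) else 0))"
      using i by (simp add: M_def v_def scalar_prod_def lessThan_atLeast0)
    also have "\<dots> = (\<Sum>j\<in>{0..k}. c (i + j) * coeff P (k - j))"
      using assms(3) by (intro sum.mono_neutral_cong_right) auto
    also have "\<dots> = (\<Sum>l\<in>{0..k}. coeff P l * c (k + i - l))"
      by (rule sum.reindex_bij_witness[of _ "\<lambda>l. k - l" "\<lambda>l. k - l"]) (auto simp: add.commute)
    also have "\<dots> = (\<Sum>l\<in>{0..k+i}. coeff P l * c (k + i - l))"
      using assms(2) by (intro sum.mono_neutral_left) (auto simp: coeff_eq_0)
    also have "\<dots> = fps_nth (fps_of_poly P * Abs_fps c) (k + i)"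
      by (simp add: fps_mult_nth)
    finally show ?thesis using assms(4)[OF i] by simp
  qed
  then have "M *\<^sub>v v = 0\<^sub>v n"
    by (intro eq_vecI) (auto simp: M_def)
  moreover have "v \<noteq> 0\<^sub>v n"
  proof
    assume "v = 0\<^sub>v n"
    then have "v $ (k - degree P) = 0" using assms by simp
    then show False using assms by (simp add: v_def)
  qed
  moreover have "v \<in> carrier_vec n" by (simp add: v_def)
  ultimately have "det M = 0"
    using det_0_iff_vec_prod_zero[OF M] by blast
  then show ?thesis by (simp add: hankel_det_def M_def)
qed

text \<open>The easy half of Kronecker's rationality criterion: a window started at
  \<open>n - 1\<close> contains only indices that are at least \<open>g\<close>.\<close>

lemma hankel_zero_if_rational:
  assumes "P \<noteq> 0" "\<And>i. i \<ge> g \<Longrightarrow> fps_nth (fps_of_poly P * Abs_fps c) i = 0"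
    and "n > degree P" "n > g"
  shows "hankel_det c n = 0"
  by (rule hankel_det_eq_0I[of P "n - 1"]) (use assms in auto)

text \<open>The \<open>n\<close> linear conditions on \<open>n + 1\<close> coefficients always have
  a nonzero solution; the determinant enters to make the constant term nonzero, which later keeps
  the denominator from vanishing at points tending to 0.\<close>

lemma pade_denominator:
  assumes "hankel_det c n \<noteq> 0"
  shows "\<exists>Q. degree Q \<le> n \<and> coeff Q 0 \<noteq> 0 \<and>
    (\<forall>i\<in>{n..<2 * n}. fps_nth (fps_of_poly Q * Abs_fps c) i = 0)"
proof -
  obtain x where x: "\<exists>j<Suc n. x j \<noteq> 0"
    and eq: "\<And>i. i < n \<Longrightarrow> (\<Sum>j<Suc n. c (n + i - j) * x j) = 0"
    using int_homogeneous_solution[of n "Suc n" "\<lambda>i j. c (n + i - j)"] by auto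
  obtain Q where Q: "degree Q \<le> n" "\<And>j. coeff Q j = (if j \<le> n then x j else 0)"
    using poly_with_coeffs[of n x] by auto
  have "Q \<noteq> 0" using x Q(2) by (metis coeff_0 less_Suc_eq_le)
  have van: "fps_nth (fps_of_poly Q * Abs_fps c) (n + i) = 0" if "i < n" for i
  proof -
    have "fps_nth (fps_of_poly Q * Abs_fps c) (n + i) = (\<Sum>l\<in>{0..n+i}. coeff Q l * c (n + i - l))"
      by (simp add: fps_mult_nth)
    also have "\<dots> = (\<Sum>l<Suc n. c (n + i - l) * x l)"
      by (intro sum.mono_neutral_cong_right) (auto simp: Q(2))
    finally show ?thesis using eq[OF that] by simp
  qed
  \<comment> \<open>If z divided \<open>Q\<close>, the quotient would have degree at most
    \<open>n - 1\<close> and its zero coefficients would sit at \<open>n - 1\<close>, ...,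
    \<open>2 * n - 2\<close>, forcing the determinant to vanish.\<close>
  have "coeff Q 0 \<noteq> 0"
  proof
    assume "coeff Q 0 = 0"
    then obtain Q' where Q': "Q = pCons 0 Q'"
      by (metis coeff_pCons_0 pCons_cases)
    with \<open>Q \<noteq> 0\<close> have "Q' \<noteq> 0" by auto
    have "n > 0" "degree Q' \<le> n - 1"
      using Q(1) Q' \<open>Q' \<noteq> 0\<close> by (auto simp: degree_pCons_eq)
    have "fps_nth (fps_of_poly Q' * Abs_fps c) (n - 1 + i) = 0" if "i < n" for i
    proof -
      have "fps_of_poly Q * Abs_fps c = fps_X * (fps_of_poly Q' * Abs_fps c)"
        unfolding Q' by (simp only: fps_of_poly_pCons) (simp add: mult_ac)
      then have "fps_nth (fps_of_poly Q * Abs_fps c) (n + i)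
          = fps_nth (fps_of_poly Q' * Abs_fps c) (n + i - 1)"
        using \<open>n > 0\<close> by (simp only: fps_X_mult_nth) simp
      with van[OF that] \<open>n > 0\<close> show ?thesis by simp
    qed
    then have "hankel_det c n = 0"
      using \<open>n > 0\<close> \<open>Q' \<noteq> 0\<close> \<open>degree Q' \<le> n - 1\<close> by (intro hankel_det_eq_0I[of Q' "n - 1"]) auto
    with assms show False by simp
  qed
  moreover have "\<forall>i\<in>{n..<2 * n}. fps_nth (fps_of_poly Q * Abs_fps c) i = 0"
  proof
    fix i assume "i \<in> {n..<2 * n}"
    then show "fps_nth (fps_of_poly Q * Abs_fps c) i = 0"
      using van[of "i - n"] by (cases "i - n < n") auto
  qed
  ultimately show ?thesis using Q(1) by blast
qed

lemma fps_factor_leading: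
  fixes F :: "int fps"
  assumes "F \<noteq> 0"
  shows "\<exists>G. fps_nth G 0 \<noteq> 0 \<and> F = fps_X ^ subdegree F * G"
  using assms by (intro exI[of _ "fps_shift (subdegree F) F"])
    (metis fps_shift_nth add_0 nth_subdegree_nonzero subdegree_decompose mult.commute)

text \<open>The determinant at \<open>n'\<close> caps the order of the remainder: if the
  coefficients \<open>n\<close>, ..., \<open>n + n' - 1\<close> of \<open>Q\<close> times the series
  were all 0, \<open>hankel_det_eq_0I\<close> with \<open>k = n < n'\<close> would make that
  determinant 0.\<close>

lemma pade_approximant:
  assumes "hankel_det c n \<noteq> 0" "hankel_det c n' \<noteq> 0" "n < n'"
  shows "\<exists>Q P G e. degree Q \<le> n \<and> degree P \<le> n \<and> coeff Q 0 \<noteq> 0 \<and> 2 * n \<le> e \<and> e < n + n' \<and>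
    fps_nth G 0 \<noteq> 0 \<and> fps_of_poly Q * Abs_fps c = fps_of_poly P + fps_X ^ e * G"
proof -
  obtain Q where Q: "degree Q \<le> n" "coeff Q 0 \<noteq> 0"
      "\<And>i. n \<le> i \<Longrightarrow> i < 2 * n \<Longrightarrow> fps_nth (fps_of_poly Q * Abs_fps c) i = 0"
    using pade_denominator[OF assms(1)] by auto
  define H where "H = fps_of_poly Q * Abs_fps c"
  \<comment> \<open>Coefficient \<open>n\<close> of \<open>P\<close> is 0 as well, so that a nonzero
    coefficient of \<open>H\<close> from index \<open>n\<close> on survives in the
    remainder.\<close>
  obtain P where P: "degree P \<le> n" "\<And>j. coeff P j = (if j \<le> n then (if j < n then fps_nth H j else 0) else 0)"
    using poly_with_coeffs[of n "\<lambda>j. if j < n then fps_nth H j else 0"] by blast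
  define R where "R = H - fps_of_poly P"
  have R0: "fps_nth R i = 0" if "i < 2 * n" for i
    using that Q(3)[of i] by (auto simp: R_def H_def[symmetric] P(2))
  have "\<exists>i. i < n' \<and> fps_nth H (n + i) \<noteq> 0"
  proof (rule ccontr)
    assume "\<not> ?thesis"
    moreover have "Q \<noteq> 0" using Q(2) by auto
    ultimately show False
      using hankel_det_eq_0I[of Q n n' c] assms Q(1) by (auto simp: H_def)
  qed
  then obtain i where "i < n'" "fps_nth H (n + i) \<noteq> 0" by blast
  then have i: "i < n'" "fps_nth R (n + i) \<noteq> 0"
    by (cases i; simp add: R_def P(2))+
  then have "R \<noteq> 0" by auto
  then obtain G where G: "fps_nth G 0 \<noteq> 0" "R = fps_X ^ subdegree R * G"
    using fps_factor_leading by blast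
  have "2 * n \<le> subdegree R" using R0 \<open>R \<noteq> 0\<close> by (meson nth_subdegree_nonzero not_le)
  moreover have "subdegree R < n + n'" using i subdegree_leI[of R "n + i"] by linarith
  moreover have "H = fps_of_poly P + fps_X ^ subdegree R * G"
    using G(2) by (simp add: R_def)
  ultimately show ?thesis
    using Q(1,2) P(1) G(1) unfolding H_def by blast
qed

section \<open>Integer power series on the unit disc\<close>

text \<open>Absolute convergence at nonnegative radii depends on the coefficients only, so one
  predicate serves real and complex arguments and passes through Cauchy products.\<close>

definition unit_disc_summable :: "int fps \<Rightarrow> bool" where
  "unit_disc_summable F \<longleftrightarrow>
     (\<forall>r. 0 \<le> r \<and> r < 1 \<longrightarrow> summable (\<lambda>j. \<bar>real_of_int (fps_nth F j)\<bar> * r ^ j))"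

abbreviation int_poly_eval :: "int poly \<Rightarrow> 'a::real_normed_field \<Rightarrow> 'a" where
  "int_poly_eval P z \<equiv> poly (map_poly of_int P) z"

lemma int_poly_eval_altdef:
  assumes "degree P \<le> n"
  shows "int_poly_eval P z = (\<Sum>i\<le>n. of_int (coeff P i) * z ^ i)"
proof -
  have "degree (map_poly of_int P :: 'a poly) = degree P" by (simp add: degree_map_poly)
  then have "int_poly_eval P z = (\<Sum>i\<le>degree P. of_int (coeff P i) * z ^ i)"
    by (simp add: poly_altdef coeff_map_poly)
  also have "\<dots> = (\<Sum>i\<le>n. of_int (coeff P i) * z ^ i)"
    using assms by (intro sum.mono_neutral_left) (auto simp: coeff_eq_0)
  finally show ?thesis .
qed

lemma unit_disc_summable_norm:
  fixes z :: "'a::real_normed_field"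
  assumes "unit_disc_summable F" "norm z < 1"
  shows "summable (\<lambda>j. norm (of_int (fps_nth F j) * z ^ j))"
  using assms by (simp add: unit_disc_summable_def norm_mult norm_power)

lemma unit_disc_summable_sums:
  fixes z :: "'a::{real_normed_field,banach}"
  assumes "unit_disc_summable F" "norm z < 1"
  shows "(\<lambda>j. of_int (fps_nth F j) * z ^ j) sums pser (fps_nth F) z"
  unfolding pser_def
  by (rule summable_sums, rule summable_norm_cancel, rule unit_disc_summable_norm[OF assms])

lemma unit_disc_summable_Abs_fps:
  assumes "\<And>z::complex. norm z < 1 \<Longrightarrow> summable (\<lambda>j. of_int (c j) * z ^ j)"
  shows "unit_disc_summable (Abs_fps c)"
  unfolding unit_disc_summable_def
proof safe
  fix r :: real assume r: "0 \<le> r" "r < 1"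
  \<comment> \<open>Convergence at a point strictly between \<open>r\<close> and 1 gives absolute
    convergence at \<open>r\<close>.\<close>
  define s where "s = (r + 1) / 2"
  have "summable (\<lambda>j. of_int (c j) * complex_of_real s ^ j)"
    using r by (intro assms) (auto simp: s_def)
  then have "summable (\<lambda>j. norm (of_int (c j) * complex_of_real r ^ j))"
    by (rule powser_insidea) (use r in \<open>simp add: s_def\<close>)
  then show "summable (\<lambda>j. \<bar>real_of_int (fps_nth (Abs_fps c) j)\<bar> * r ^ j)"
    using r by (simp add: norm_mult norm_power)
qed

section \<open>Ring operations on integer power series and their evaluation\<close>

lemma unit_disc_summable_add:
  assumes "unit_disc_summable F" "unit_disc_summable G"
  shows "unit_disc_summable (F + G)"
  unfolding unit_disc_summable_def
proof safe
  fix r :: real assume r: "0 \<le> r" "r < 1"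
  have "summable (\<lambda>j. \<bar>real_of_int (fps_nth F j)\<bar> * r ^ j + \<bar>real_of_int (fps_nth G j)\<bar> * r ^ j)"
    using assms r by (intro summable_add) (auto simp: unit_disc_summable_def)
  then show "summable (\<lambda>j. \<bar>real_of_int (fps_nth (F + G) j)\<bar> * r ^ j)"
  proof (rule summable_comparison_test[rotated], intro exI allI impI)
    fix j
    show "norm (\<bar>real_of_int (fps_nth (F + G) j)\<bar> * r ^ j) \<le>
      \<bar>real_of_int (fps_nth F j)\<bar> * r ^ j + \<bar>real_of_int (fps_nth G j)\<bar> * r ^ j"
      using r by (simp add: abs_mult flip: distrib_right) (intro mult_right_mono, auto)
  qed
qed

text \<open>Serves both summability and values of products: once \<open>z ^ n\<close> is split over
  the convolution, the sum is a Cauchy product of two evaluated series.\<close>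

lemma fps_mult_nth_of_int:
  fixes z :: "'a::real_normed_field"
  shows "of_int (fps_nth (F * G) n) * z ^ n =
    (\<Sum>i\<le>n. (of_int (fps_nth F i) * z ^ i) * (of_int (fps_nth G (n - i)) * z ^ (n - i)))"
proof -
  have "(of_int (fps_nth F i) * z ^ i) * (of_int (fps_nth G (n - i)) * z ^ (n - i))
      = of_int (fps_nth F i) * of_int (fps_nth G (n - i)) * z ^ n" if "i \<le> n" for i
    using that by (simp add: mult_ac flip: power_add)
  then show ?thesis
    unfolding fps_mult_nth of_int_sum of_int_mult sum_distrib_right atMost_atLeast0
    by (intro sum.cong refl) (metis atLeastAtMost_iff)
qed

lemma unit_disc_summable_mult:
  assumes "unit_disc_summable F" "unit_disc_summable G"
  shows "unit_disc_summable (F * G)"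
  unfolding unit_disc_summable_def
proof safe
  fix r :: real assume r: "0 \<le> r" "r < 1"
  let ?f = "\<lambda>j. \<bar>real_of_int (fps_nth F j)\<bar> * r ^ j"
  let ?g = "\<lambda>j. \<bar>real_of_int (fps_nth G j)\<bar> * r ^ j"
  have "summable (\<lambda>n. \<Sum>i\<le>n. ?f i * ?g (n - i))"
    using assms r by (intro summable_Cauchy_product) (auto simp: unit_disc_summable_def)
  then show "summable (\<lambda>n. \<bar>real_of_int (fps_nth (F * G) n)\<bar> * r ^ n)"
  proof (rule summable_comparison_test[rotated], intro exI allI impI)
    fix n
    have "norm (\<bar>real_of_int (fps_nth (F * G) n)\<bar> * r ^ n) = \<bar>real_of_int (fps_nth (F * G) n) * r ^ n\<bar>"
      by (simp add: abs_mult)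
    also have "\<dots> \<le> (\<Sum>i\<le>n. \<bar>(real_of_int (fps_nth F i) * r ^ i) * (real_of_int (fps_nth G (n - i)) * r ^ (n - i))\<bar>)"
      unfolding fps_mult_nth_of_int by (rule sum_abs)
    also have "\<dots> = (\<Sum>i\<le>n. ?f i * ?g (n - i))"
      using r by (simp add: abs_mult)
    finally show "norm (\<bar>real_of_int (fps_nth (F * G) n)\<bar> * r ^ n) \<le> \<dots>" .
  qed
qed

lemma pser_fps_mult:
  fixes z :: "'a::{real_normed_field,banach}"
  assumes "unit_disc_summable F" "unit_disc_summable G" "norm z < 1"
  shows "pser (fps_nth (F * G)) z = pser (fps_nth F) z * pser (fps_nth G) z"
  unfolding pser_def fps_mult_nth_of_int
  using assms by (intro Cauchy_product[symmetric] unit_disc_summable_norm)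

lemma pser_fps_add:
  fixes z :: "'a::{real_normed_field,banach}"
  assumes "unit_disc_summable F" "unit_disc_summable G" "norm z < 1"
  shows "pser (fps_nth (F + G)) z = pser (fps_nth F) z + pser (fps_nth G) z"
proof -
  have "(\<lambda>j. of_int (fps_nth (F + G) j) * z ^ j) sums (pser (fps_nth F) z + pser (fps_nth G) z)"
    using sums_add[OF unit_disc_summable_sums[OF assms(1,3)] unit_disc_summable_sums[OF assms(2,3)]]
    by (simp add: distrib_right)
  then show ?thesis unfolding pser_def[of "fps_nth (F + G)"] by (rule sums_unique[symmetric])
qed

lemma unit_disc_summable_poly: "unit_disc_summable (fps_of_poly P)"
  unfolding unit_disc_summable_def
  by (intro allI impI summable_finite[of "{..degree P}"]) (auto simp: coeff_eq_0)

lemma pser_fps_of_poly: "pser (fps_nth (fps_of_poly P)) z = int_poly_eval P z"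
proof -
  have "(\<Sum>i\<le>degree P. of_int (coeff P i) * z ^ i) = (\<Sum>i. of_int (coeff P i) * z ^ i)"
    by (intro suminf_finite[symmetric]) (auto simp: coeff_eq_0)
  then show ?thesis by (simp add: pser_def int_poly_eval_altdef[OF order_refl])
qed

lemma unit_disc_summable_one: "unit_disc_summable 1"
  using unit_disc_summable_poly[of 1] by simp

lemma unit_disc_summable_zero: "unit_disc_summable 0"
  using unit_disc_summable_poly[of 0] by simp

lemma unit_disc_summable_power: "unit_disc_summable F \<Longrightarrow> unit_disc_summable (F ^ k)"
  by (induction k) (auto intro: unit_disc_summable_one unit_disc_summable_mult)

lemma pser_fps_one: "pser (fps_nth 1) z = 1"
proof -
  have "int_poly_eval 1 z = 1" by simp
  then show ?thesis using pser_fps_of_poly[of 1 z] unfolding fps_of_poly_1 by (rule trans[rotated])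
qed

lemma pser_fps_zero: "pser (fps_nth 0) z = 0"
  using pser_fps_of_poly[of 0 z] by (simp only: fps_of_poly_0) simp

lemma pser_fps_power:
  fixes z :: "'a::{real_normed_field,banach}"
  assumes "unit_disc_summable F" "norm z < 1"
  shows "pser (fps_nth (F ^ k)) z = pser (fps_nth F) z ^ k"
proof (induction k)
  case 0
  show ?case unfolding power_0 by (rule pser_fps_one)
next
  case (Suc k)
  then show ?case by (simp add: pser_fps_mult unit_disc_summable_power assms)
qed

lemma unit_disc_summable_sum:
  "(\<And>j. j \<in> J \<Longrightarrow> unit_disc_summable (F j)) \<Longrightarrow> unit_disc_summable (\<Sum>j\<in>J. F j)"
  by (induction J rule: infinite_finite_induct)
    (auto intro: unit_disc_summable_zero unit_disc_summable_add)

lemma pser_fps_sum: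
  fixes z :: "'a::{real_normed_field,banach}"
  assumes "\<And>j. j \<in> J \<Longrightarrow> unit_disc_summable (F j)" "norm z < 1"
  shows "pser (fps_nth (\<Sum>j\<in>J. F j)) z = (\<Sum>j\<in>J. pser (fps_nth (F j)) z)"
  using assms(1)
  by (induction J rule: infinite_finite_induct)
    (simp_all add: pser_fps_zero pser_fps_add unit_disc_summable_sum assms(2))

text \<open>Allows the leading power of z to be split off; the cofactor then has a limit at 0, which
  decides nonvanishing near 0.\<close>

lemma unit_disc_summable_X_power_cancel:
  assumes "unit_disc_summable (fps_X ^ e * G)"
  shows "unit_disc_summable G"
  unfolding unit_disc_summable_def
proof safe
  fix r :: real assume r: "0 \<le> r" "r < 1"
  show "summable (\<lambda>j. \<bar>real_of_int (fps_nth G j)\<bar> * r ^ j)"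
  proof (cases "r = 0")
    case False
    have "summable (\<lambda>j. \<bar>real_of_int (fps_nth (fps_X ^ e * G) (j + e))\<bar> * r ^ (j + e))"
      using assms r by (subst summable_iff_shift) (simp add: unit_disc_summable_def)
    moreover have "fps_nth (fps_X ^ e * G) (j + e) = fps_nth G j" for j
      by (simp add: fps_X_power_mult_nth)
    ultimately have "summable (\<lambda>j. r ^ e * (\<bar>real_of_int (fps_nth G j)\<bar> * r ^ j))"
      by (simp only: power_add mult_ac)
    then show ?thesis using False by (simp only: summable_cmult_iff) auto
  qed (simp add: summable_zero_power')
qed

lemma pser_X_power_mult:
  fixes z :: "'a::{real_normed_field,banach}"
  assumes "unit_disc_summable G" "norm z < 1"
  shows "pser (fps_nth (fps_X ^ e * G)) z = z ^ e * pser (fps_nth G) z"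
proof -
  have "pser (fps_nth (fps_of_poly (monom 1 e))) z = z ^ e"
    by (subst pser_fps_of_poly) (simp add: map_poly_monom poly_monom)
  then show ?thesis
    using pser_fps_mult[OF unit_disc_summable_poly[of "monom 1 e"] assms]
    by (simp add: fps_of_poly_monom)
qed

lemma pser_tendsto_at_0:
  fixes x :: "nat \<Rightarrow> 'a::{real_normed_field,banach}"
  assumes "unit_disc_summable G" "x \<longlonglongrightarrow> 0"
  shows "(\<lambda>m. pser (fps_nth G) (x m)) \<longlonglongrightarrow> of_int (fps_nth G 0)"
proof -
  have half: "norm (1 / 2 :: 'a) < 1" by (simp add: norm_divide)
  have "summable (\<lambda>j. of_int (fps_nth G j) * (1 / 2 :: 'a) ^ j)"
    using unit_disc_summable_sums[OF assms(1) half] by (rule sums_summable)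
  then have "isCont (pser (fps_nth G)) (0 :: 'a)"
    unfolding pser_def by (rule isCont_powser) simp
  then have "(\<lambda>m. pser (fps_nth G) (x m)) \<longlonglongrightarrow> pser (fps_nth G) (0 :: 'a)"
    using assms(2) by (rule isCont_tendsto_compose)
  moreover have "pser (fps_nth G) (0 :: 'a) = of_int (fps_nth G 0)"
    by (simp add: pser_def powser_zero)
  ultimately show ?thesis by simp
qed

lemma pser_of_real:
  assumes "unit_disc_summable F" "\<bar>x\<bar> < 1"
  shows "pser (fps_nth F) (complex_of_real x) = complex_of_real (pser (fps_nth F) x)"
proof -
  have "(\<lambda>j. complex_of_real (of_int (fps_nth F j) * x ^ j)) sums complex_of_real (pser (fps_nth F) x)"
    using unit_disc_summable_sums[of F x] assms by (intro sums_of_real) auto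
  then show ?thesis unfolding pser_def[of _ "complex_of_real x"] by (intro sums_unique[symmetric]) simp
qed

text \<open>Averaging over the \<open>K\<close>-th roots of unity replaces integration over a
  circle, so that orthogonality reduces to geometric sums.\<close>

lemma roots_of_unity_parseval:
  fixes a :: "nat \<Rightarrow> complex"
  assumes K: "K > 0"
  defines "\<omega> \<equiv> cis (2 * pi / real K)"
  shows "(\<Sum>k<K. (norm (\<Sum>j<K. a j * (\<omega> ^ k) ^ j))\<^sup>2) = real K * (\<Sum>j<K. (norm (a j))\<^sup>2)"
proof -
  have pw: "\<omega> ^ j = cis (2 * pi * real j / real K)" for j
    unfolding \<omega>_def by (simp add: Complex.DeMoivre mult_ac)
  have cw: "\<omega> * cnj \<omega> = 1" by (simp add: \<omega>_def cis_cnj cis_mult)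
  have inj: "inj_on (\<lambda>j. \<omega> ^ j) {..<K}"
    using Complex.bij_betw_roots_unity[OF K] by (simp add: pw bij_betw_def)
  have orth: "(\<Sum>k<K. (\<omega> ^ k) ^ i * cnj ((\<omega> ^ k) ^ j)) = (if i = j then of_nat K else 0)"
    if ij: "i < K" "j < K" for i j
  proof -
    \<comment> \<open>This is the power i - j of the root of unity, with the conjugate as inverse to
      avoid a negative exponent.\<close>
    define q where "q = \<omega> ^ i * cnj \<omega> ^ j"
    have "(\<omega> ^ k) ^ i * cnj ((\<omega> ^ k) ^ j) = q ^ k" for k
      by (simp add: q_def power_mult_distrib flip: power_mult) (simp add: mult.commute)
    then have *: "(\<Sum>k<K. (\<omega> ^ k) ^ i * cnj ((\<omega> ^ k) ^ j)) = (\<Sum>k<K. q ^ k)" by simp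
    have wK: "\<omega> ^ K = 1" using K by (simp add: pw)
    then have "cnj \<omega> ^ K = 1" by (metis complex_cnj_one complex_cnj_power)
    then have "q ^ K = 1"
      unfolding q_def power_mult_distrib using wK by (metis mult.commute mult_1 power_mult power_one)
    moreover have "i = j" if "q = 1"
    proof -
      have "\<omega> ^ i = \<omega> ^ i * (\<omega> * cnj \<omega>) ^ j" by (simp add: cw)
      also have "\<dots> = q * \<omega> ^ j" by (simp add: q_def power_mult_distrib)
      finally have "\<omega> ^ i = \<omega> ^ j" using that by simp
      then show ?thesis using inj_onD[OF inj] ij by auto
    qed
    moreover have "q = 1" if "i = j"
      unfolding q_def that by (simp add: cw flip: power_mult_distrib)
    ultimately show ?thesis
      unfolding * by (cases "q = 1") (auto simp: geometric_sum)
  qed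
  have "complex_of_real (\<Sum>k<K. (norm (\<Sum>j<K. a j * (\<omega> ^ k) ^ j))\<^sup>2)
      = (\<Sum>k<K. (\<Sum>i<K. a i * (\<omega> ^ k) ^ i) * cnj (\<Sum>j<K. a j * (\<omega> ^ k) ^ j))"
    by (simp only: of_real_sum complex_norm_square)
  also have "\<dots> = (\<Sum>k<K. \<Sum>i<K. \<Sum>j<K. a i * cnj (a j) * ((\<omega> ^ k) ^ i * cnj ((\<omega> ^ k) ^ j)))"
    unfolding cnj_sum sum_product by (simp add: mult_ac)
  also have "\<dots> = (\<Sum>i<K. \<Sum>k<K. \<Sum>j<K. a i * cnj (a j) * ((\<omega> ^ k) ^ i * cnj ((\<omega> ^ k) ^ j)))"
    by (rule sum.swap)
  also have "\<dots> = (\<Sum>i<K. \<Sum>j<K. \<Sum>k<K. a i * cnj (a j) * ((\<omega> ^ k) ^ i * cnj ((\<omega> ^ k) ^ j)))"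
    by (intro sum.cong refl sum.swap)
  also have "\<dots> = (\<Sum>i<K. \<Sum>j<K. a i * cnj (a j) * (if i = j then of_nat K else 0))"
    by (intro sum.cong refl) (simp only: orth lessThan_iff flip: sum_distrib_left)
  also have "\<dots> = (\<Sum>i<K. a i * cnj (a i) * of_nat K)"
  proof (intro sum.cong refl)
    fix i assume "i \<in> {..<K}"
    then have "(\<Sum>j<K. a i * cnj (a j) * (if i = j then of_nat K else 0)) = (\<Sum>j\<in>{i}. a i * cnj (a j) * of_nat K)"
      by (intro sum.mono_neutral_cong_right) auto
    then show "(\<Sum>j<K. a i * cnj (a j) * (if i = j then of_nat K else 0)) = a i * cnj (a i) * of_nat K"
      by simp
  qed
  also have "\<dots> = complex_of_real (real K * (\<Sum>j<K. (norm (a j))\<^sup>2))"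
    by (simp only: of_real_sum of_real_mult complex_norm_square sum_distrib_left) (simp add: mult_ac)
  finally show ?thesis by (simp only: of_real_eq_iff)
qed

text \<open>By Parseval the squares of the coefficients sum to at most \<open>M\<^sup>2\<close>, and
  each nonzero integer contributes at least 1, so only finitely many are nonzero.\<close>

lemma bounded_int_fps_finite_support:
  assumes F: "unit_disc_summable F"
    and M: "\<And>z::complex. norm z < 1 \<Longrightarrow> norm (pser (fps_nth F) z) \<le> M"
  shows "\<exists>g. \<forall>i\<ge>g. fps_nth F i = 0"
proof -
  define a where "a = (\<lambda>j. real_of_int (fps_nth F j))"
  have sq_r: "(\<Sum>j<N. (a j)\<^sup>2 * r ^ (2 * j)) \<le> M\<^sup>2" if r: "0 < r" "r < 1" for N r
  proof -
    \<comment> \<open>The tail of the absolute series bounds, on the whole circle of radius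
      \<open>r\<close>, the error of cutting after \<open>K\<close> terms; the finite Parseval
      identity handles the polynomial that is left.\<close>
    define T where "T = (\<lambda>K. \<Sum>j. \<bar>a (j + K)\<bar> * r ^ (j + K))"
    have sm: "summable (\<lambda>j. \<bar>a j\<bar> * r ^ j)"
      using F r by (simp add: unit_disc_summable_def a_def)
    have T0: "T \<longlonglongrightarrow> 0"
      unfolding T_def using suminf_exist_split[OF _ sm] by (intro LIMSEQ_I) simp
    have bnd: "(\<Sum>j<N. (a j)\<^sup>2 * r ^ (2 * j)) \<le> (M + T K)\<^sup>2" if "K \<ge> N" "K > 0" for K
    proof -
      define \<omega> where "\<omega> = cis (2 * pi / real K)"
      have nw: "norm (\<omega> ^ k) = 1" for k by (simp add: \<omega>_def norm_power)
      have part: "norm (\<Sum>j<K. of_real (a j * r ^ j) * (\<omega> ^ k) ^ j) \<le> M + T K" for k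
      proof -
        define z where "z = of_real r * \<omega> ^ k"
        have nz: "norm z = r" using r nw by (simp add: z_def norm_mult)
        have summ: "summable (\<lambda>j. of_int (fps_nth F j) * z ^ j)"
          using unit_disc_summable_sums[OF F, of z] nz r by (auto dest: sums_summable)
        have "pser (fps_nth F) z = (\<Sum>j. of_int (fps_nth F (j + K)) * z ^ (j + K))
            + (\<Sum>j<K. of_int (fps_nth F j) * z ^ j)"
          unfolding pser_def by (rule suminf_split_initial_segment[OF summ])
        then have "(\<Sum>j<K. of_int (fps_nth F j) * z ^ j)
            = pser (fps_nth F) z - (\<Sum>j. of_int (fps_nth F (j + K)) * z ^ (j + K))" by simp
        also have "norm \<dots> \<le> norm (pser (fps_nth F) z) + norm (\<Sum>j. of_int (fps_nth F (j + K)) * z ^ (j + K))"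
          by (rule norm_triangle_ineq4)
        also have "norm (pser (fps_nth F) z) \<le> M" using M nz r by simp
        also have "norm (\<Sum>j. of_int (fps_nth F (j + K)) * z ^ (j + K)) \<le> T K"
        proof -
          have "norm (\<Sum>j. of_int (fps_nth F (j + K)) * z ^ (j + K)) \<le>
              (\<Sum>j. norm (of_int (fps_nth F (j + K)) * z ^ (j + K)))"
            using unit_disc_summable_norm[OF F, of z] nz r
            by (intro summable_norm) (subst summable_iff_shift, simp)
          also have "\<dots> = T K"
            unfolding T_def a_def by (intro suminf_cong) (simp only: norm_mult norm_power nz norm_of_int)
          finally show ?thesis .
        qed
        finally have "norm (\<Sum>j<K. of_int (fps_nth F j) * z ^ j) \<le> M + T K" by simp
        moreover have "(\<Sum>j<K. of_int (fps_nth F j) * z ^ j) = (\<Sum>j<K. of_real (a j * r ^ j) * (\<omega> ^ k) ^ j)"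
          by (simp add: z_def a_def power_mult_distrib mult_ac)
        ultimately show ?thesis by simp
      qed
      have "real K * (\<Sum>j<K. (norm (complex_of_real (a j * r ^ j)))\<^sup>2)
          = (\<Sum>k<K. (norm (\<Sum>j<K. of_real (a j * r ^ j) * (\<omega> ^ k) ^ j))\<^sup>2)"
        unfolding \<omega>_def by (rule roots_of_unity_parseval[OF that(2), symmetric])
      also have "\<dots> \<le> (\<Sum>k<K. (M + T K)\<^sup>2)"
        using part by (intro sum_mono power_mono) auto
      also have "\<dots> = real K * (M + T K)\<^sup>2" by simp
      finally have "(\<Sum>j<K. (norm (complex_of_real (a j * r ^ j)))\<^sup>2) \<le> (M + T K)\<^sup>2"
        using that(2) by (simp only: mult_le_cancel_left_pos of_nat_0_less_iff)
      moreover have "(norm (complex_of_real (a j * r ^ j)))\<^sup>2 = (a j)\<^sup>2 * r ^ (2 * j)" for j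
        unfolding norm_of_real power2_abs power_mult_distrib by (simp add: mult.commute flip: power_mult)
      ultimately have "(\<Sum>j<K. (a j)\<^sup>2 * r ^ (2 * j)) \<le> (M + T K)\<^sup>2" by (simp only:)
      moreover have "(\<Sum>j<N. (a j)\<^sup>2 * r ^ (2 * j)) \<le> (\<Sum>j<K. (a j)\<^sup>2 * r ^ (2 * j))"
        using that r by (intro sum_mono2) auto
      ultimately show ?thesis by linarith
    qed
    have "(\<lambda>K. (M + T K)\<^sup>2) \<longlonglongrightarrow> (M + 0)\<^sup>2"
      by (intro tendsto_intros T0)
    then have "(\<lambda>K. (M + T K)\<^sup>2) \<longlonglongrightarrow> M\<^sup>2" by (simp only: add_0_right)
    moreover have "\<forall>\<^sub>F K in sequentially. (\<Sum>j<N. (a j)\<^sup>2 * r ^ (2 * j)) \<le> (M + T K)\<^sup>2"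
      using bnd by (intro eventually_sequentiallyI[of "Suc N"]) simp
    ultimately show ?thesis by (rule tendsto_lowerbound) simp
  qed
  have sq: "(\<Sum>j<N. (a j)\<^sup>2) \<le> M\<^sup>2" for N
  proof -
    \<comment> \<open>With \<open>N\<close> fixed this is a finite sum, so the radius may tend to 1
      termwise.\<close>
    have "((\<lambda>r. \<Sum>j<N. (a j)\<^sup>2 * r ^ (2 * j)) \<longlongrightarrow> (\<Sum>j<N. (a j)\<^sup>2 * 1 ^ (2 * j))) (at_left (1::real))"
      by (intro tendsto_intros)
    moreover have "\<forall>\<^sub>F r in at_left (1::real). (\<Sum>j<N. (a j)\<^sup>2 * r ^ (2 * j)) \<le> M\<^sup>2"
      using eventually_at_left_real[of 0 1] by (rule eventually_mono) (auto intro: sq_r)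
    ultimately show ?thesis
      by (intro tendsto_upperbound[where F = "at_left (1::real)"]) auto
  qed
  have "finite {j. fps_nth F j \<noteq> 0}"
  proof (rule ccontr)
    assume "infinite {j. fps_nth F j \<noteq> 0}"
    then obtain S where S: "finite S" "card S = nat \<lceil>M\<^sup>2\<rceil> + 1" "S \<subseteq> {j. fps_nth F j \<noteq> 0}"
      using infinite_arbitrarily_large by blast
    obtain N where N: "S \<subseteq> {..<N}" using S(1) finite_nat_iff_bounded by blast
    have "real (card S) = (\<Sum>j\<in>S. 1)" by simp
    also have "\<dots> \<le> (\<Sum>j\<in>S. (a j)\<^sup>2)"
    proof (rule sum_mono)
      fix j assume "j \<in> S"
      then have "1 \<le> \<bar>fps_nth F j\<bar>" using S(3) by auto
      then have "1 \<le> \<bar>a j\<bar>" unfolding a_def by linarith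
      then have "1 \<le> \<bar>a j\<bar>\<^sup>2" by (rule one_le_power)
      then show "1 \<le> (a j)\<^sup>2" by simp
    qed
    also have "\<dots> \<le> (\<Sum>j<N. (a j)\<^sup>2)" using N by (intro sum_mono2) auto
    also have "\<dots> \<le> M\<^sup>2" by (rule sq)
    finally show False using S(2) by linarith
  qed
  then obtain g where "{j. fps_nth F j \<noteq> 0} \<subseteq> {..<g}" using finite_nat_iff_bounded by blast
  then show ?thesis by (intro exI[of _ g]) (auto simp: subset_iff not_less[symmetric])
qed

section \<open>Algebraic independence of the series from polynomials\<close>

text \<open>The length of a polynomial: it is submultiplicative without degree factors and bounds
  the values on the closed unit disc.\<close>

definition poly_l1 :: "int poly \<Rightarrow> real" where
  "poly_l1 P = (\<Sum>i\<le>degree P. \<bar>real_of_int (coeff P i)\<bar>)"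

lemma poly_l1_eq:
  assumes "degree P \<le> n"
  shows "poly_l1 P = (\<Sum>i\<le>n. \<bar>real_of_int (coeff P i)\<bar>)"
  unfolding poly_l1_def using assms by (intro sum.mono_neutral_left) (auto simp: coeff_eq_0)

lemma poly_l1_nonneg: "0 \<le> poly_l1 P"
  by (simp add: poly_l1_def sum_nonneg)

lemma poly_l1_add: "poly_l1 (P + Q) \<le> poly_l1 P + poly_l1 Q"
proof -
  define n where "n = max (degree P) (degree Q)"
  have "degree (P + Q) \<le> n" "degree P \<le> n" "degree Q \<le> n"
    by (auto simp: n_def intro: degree_add_le)
  then show ?thesis
    by (simp add: poly_l1_eq[of _ n] flip: sum.distrib) (intro sum_mono, linarith)
qed

lemma poly_l1_pCons: "poly_l1 (pCons a P) = \<bar>real_of_int a\<bar> + poly_l1 P"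
proof -
  have "degree (pCons a P) \<le> Suc (degree P)" by (rule degree_pCons_le)
  then show ?thesis
    unfolding poly_l1_eq[OF \<open>degree (pCons a P) \<le> Suc (degree P)\<close>] sum.atMost_Suc_shift
    by (simp add: poly_l1_def)
qed

lemma poly_l1_0: "poly_l1 0 = 0"
  by (simp add: poly_l1_def)

lemma poly_l1_smult: "poly_l1 (smult a P) = \<bar>real_of_int a\<bar> * poly_l1 P"
  by (induction P) (simp_all add: poly_l1_0 poly_l1_pCons distrib_left abs_mult)

lemma poly_l1_mult: "poly_l1 (P * Q) \<le> poly_l1 P * poly_l1 Q"
proof (induction P)
  case (pCons a P)
  have "poly_l1 (pCons a P * Q) \<le> poly_l1 (smult a Q) + poly_l1 (pCons 0 (P * Q))"
    unfolding mult_pCons_left by (rule poly_l1_add)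
  also have "\<dots> \<le> \<bar>real_of_int a\<bar> * poly_l1 Q + poly_l1 P * poly_l1 Q"
    using pCons.IH by (simp add: poly_l1_smult poly_l1_pCons)
  finally show ?case by (simp add: poly_l1_pCons distrib_right)
qed (simp add: poly_l1_0)

lemma poly_l1_power: "poly_l1 (P ^ k) \<le> poly_l1 P ^ k"
proof (induction k)
  case 0
  show ?case by (simp add: poly_l1_def)
next
  case (Suc k)
  have "poly_l1 (P ^ Suc k) \<le> poly_l1 P * poly_l1 (P ^ k)" by (simp add: poly_l1_mult)
  also have "\<dots> \<le> poly_l1 P * poly_l1 P ^ k"
    by (intro mult_left_mono Suc.IH poly_l1_nonneg)
  finally show ?case by simp
qed

lemma poly_l1_sum: "poly_l1 (\<Sum>j\<in>J. P j) \<le> (\<Sum>j\<in>J. poly_l1 (P j))"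
  by (induction J rule: infinite_finite_induct)
    (auto simp: poly_l1_0 intro: order_trans[OF poly_l1_add])

lemma int_poly_eval_bound:
  assumes "norm z \<le> 1"
  shows "norm (int_poly_eval P z) \<le> poly_l1 P"
  unfolding int_poly_eval_altdef[OF order_refl] poly_l1_def
proof (rule sum_norm_le)
  fix i
  show "norm (of_int (coeff P i) * z ^ i) \<le> \<bar>real_of_int (coeff P i)\<bar>"
    using assms by (simp add: norm_mult norm_power mult_left_le power_le_one)
qed

text \<open>Multiplying the relation by \<open>p s ^ (s - 1)\<close> makes \<open>p s * w\<close> a
  root of a monic equation with coefficients of norm at most \<open>M ^ s\<close>. If its norm
  exceeds 1, each lower power is at most the power \<open>s - 1\<close>, and dividing by that power
  leaves the bound.\<close>

lemma leading_multiple_of_root_bounded: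
  fixes p :: "nat \<Rightarrow> complex"
  assumes rel: "(\<Sum>j\<le>s. p j * w ^ j) = 0" and "s > 0"
    and p: "\<And>j. j \<le> s \<Longrightarrow> norm (p j) \<le> M" and "M \<ge> 1"
  shows "norm (p s * w) \<le> real s * M ^ s"
proof (cases "norm (p s * w) \<le> 1")
  case True
  moreover have "1 * 1 \<le> real s * M ^ s" using assms by (intro mult_mono) auto
  ultimately show ?thesis by simp
next
  case False
  define y where "y = p s * w"
  have y1: "norm y > 1" using False by (simp add: y_def)
  have "p s * w ^ s = - (\<Sum>j<s. p j * w ^ j)"
    using rel by (simp add: lessThan_Suc_atMost[symmetric] eq_neg_iff_add_eq_0 add.commute)
  moreover have "y ^ s = p s ^ (s - 1) * (p s * w ^ s)"
    using \<open>s > 0\<close> by (cases s) (simp_all add: y_def power_mult_distrib mult_ac)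
  ultimately have "y ^ s = - (p s ^ (s - 1) * (\<Sum>j<s. p j * w ^ j))" by simp
  also have "\<dots> = - (\<Sum>j<s. p j * p s ^ (s - 1 - j) * y ^ j)"
  proof -
    have "p s ^ (s - 1) = p s ^ (s - 1 - j) * p s ^ j" if "j < s" for j
      using that by (simp flip: power_add)
    then show ?thesis
      by (simp add: sum_distrib_left y_def power_mult_distrib mult_ac)
  qed
  finally have "norm y ^ s = norm (\<Sum>j<s. p j * p s ^ (s - 1 - j) * y ^ j)"
    by (metis norm_minus_cancel norm_power)
  also have "\<dots> \<le> (\<Sum>j<s. M ^ s * norm y ^ (s - 1))"
  proof (rule sum_norm_le)
    fix j assume "j \<in> {..<s}"
    then have j: "j < s" by simp
    have "norm (p j) * norm (p s) ^ (s - 1 - j) * norm y ^ j \<le> M * M ^ (s - 1 - j) * norm y ^ (s - 1)"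
      using p j y1 \<open>M \<ge> 1\<close> by (intro mult_mono power_mono power_increasing) auto
    also have "M * M ^ (s - 1 - j) \<le> M ^ s"
      using \<open>M \<ge> 1\<close> j by (simp add: power_increasing flip: power_Suc)
    finally show "norm (p j * p s ^ (s - 1 - j) * y ^ j) \<le> M ^ s * norm y ^ (s - 1)"
      by (simp add: norm_mult norm_power mult_right_mono)
  qed
  finally have "norm y * norm y ^ (s - 1) \<le> (real s * M ^ s) * norm y ^ (s - 1)"
    using \<open>s > 0\<close> by (cases s) simp_all
  moreover have "0 < norm y ^ (s - 1)" using y1 by (intro zero_less_power) linarith
  ultimately have "norm y \<le> real s * M ^ s"
    by (simp only: mult_le_cancel_right_pos)
  then show ?thesis by (simp add: y_def)
qed

lemma fps_transcendental:
  assumes F: "unit_disc_summable (Abs_fps c)"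
    and hank: "\<And>g. \<exists>n>g. hankel_det c n \<noteq> 0"
    and rel: "(\<Sum>j\<le>N. fps_of_poly (P j) * Abs_fps c ^ j) = 0"
  shows "\<forall>j\<le>N. P j = 0"
proof (rule ccontr)
  assume nz: "\<not> ?thesis"
  define J where "J = {j. j \<le> N \<and> P j \<noteq> 0}"
  have J: "finite J" "J \<noteq> {}" using nz by (auto simp: J_def)
  \<comment> \<open>Cutting at the largest index with \<open>P j \<noteq> 0\<close> gives the
    relation a genuine leading coefficient. This \<open>s\<close> is positive, since a single
    nonzero polynomial is not the zero series.\<close>
  define s where "s = Max J"
  have "s \<in> J" using J by (simp add: s_def)
  then have s: "s \<le> N" "P s \<noteq> 0" by (auto simp: J_def)
  have "j \<le> s" if "j \<le> N" "P j \<noteq> 0" for j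
    using that J by (auto simp: s_def J_def)
  then have above: "P j = 0" if "s < j" "j \<le> N" for j using that by force
  let ?F = "Abs_fps c"
  have "(\<Sum>j\<le>s. fps_of_poly (P j) * ?F ^ j) = (\<Sum>j\<le>N. fps_of_poly (P j) * ?F ^ j)"
    using s above by (intro sum.mono_neutral_left) (auto simp: not_le)
  then have rel': "(\<Sum>j\<le>s. fps_of_poly (P j) * ?F ^ j) = 0" using rel by simp
  have "s > 0"
    using rel' s(2) by (cases s) auto
  \<comment> \<open>Bounds all coefficients on the disc at once; the summand 1 secures
    \<open>M \<ge> 1\<close>.\<close>
  define M where "M = 1 + (\<Sum>j\<le>s. poly_l1 (P j))"
  define G where "G = fps_of_poly (P s) * ?F"
  have G: "unit_disc_summable G"
    unfolding G_def by (intro unit_disc_summable_mult unit_disc_summable_poly F)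
  have "norm (pser (fps_nth G) z) \<le> real s * M ^ s" if z: "norm z < 1" for z :: complex
  proof -
    define w where "w = pser (fps_nth ?F) z"
    have "0 = pser (fps_nth (\<Sum>j\<le>s. fps_of_poly (P j) * ?F ^ j)) z"
      by (simp add: rel' pser_fps_zero)
    also have "\<dots> = (\<Sum>j\<le>s. int_poly_eval (P j) z * w ^ j)"
      using F z by (subst pser_fps_sum)
        (auto simp: unit_disc_summable_mult unit_disc_summable_poly unit_disc_summable_power
          pser_fps_mult pser_fps_of_poly pser_fps_power w_def)
    finally have sum0: "(\<Sum>j\<le>s. int_poly_eval (P j) z * w ^ j) = 0" by simp
    have "norm (int_poly_eval (P j) z) \<le> M" if "j \<le> s" for j
    proof -
      have "norm (int_poly_eval (P j) z) \<le> poly_l1 (P j)" using z by (intro int_poly_eval_bound) auto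
      also have "\<dots> \<le> (\<Sum>j\<le>s. poly_l1 (P j))" using that by (intro member_le_sum) (auto simp: poly_l1_nonneg)
      finally show ?thesis by (simp add: M_def)
    qed
    moreover have "M \<ge> 1" by (simp add: M_def sum_nonneg poly_l1_nonneg)
    ultimately have "norm (int_poly_eval (P s) z * w) \<le> real s * M ^ s"
      by (rule leading_multiple_of_root_bounded[OF sum0 \<open>s > 0\<close>])
    moreover have "pser (fps_nth G) z = int_poly_eval (P s) z * w"
      unfolding G_def w_def using F z by (simp add: pser_fps_mult unit_disc_summable_poly pser_fps_of_poly)
    ultimately show ?thesis by simp
  qed
  then obtain g where g: "\<And>i. i \<ge> g \<Longrightarrow> fps_nth G i = 0"
    using bounded_int_fps_finite_support[OF G] by blast
  obtain n where "n > max g (degree (P s))" "hankel_det c n \<noteq> 0" using hank by blast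
  then show False
    using hankel_zero_if_rational[of "P s" g c n] s(2) g by (auto simp: G_def)
qed

section \<open>Liouville's inequality\<close>

lemma abs_det_le:
  fixes A :: "int mat"
  assumes A: "A \<in> carrier_mat n n" and B: "\<And>i j. i < n \<Longrightarrow> j < n \<Longrightarrow> \<bar>real_of_int (A $$ (i, j))\<bar> \<le> B"
  shows "\<bar>real_of_int (det A)\<bar> \<le> fact n * B ^ n"
proof -
  have "\<bar>real_of_int (det A)\<bar> =
      \<bar>\<Sum>p | p permutes {0..<n}. real_of_int (signof p) * (\<Prod>i = 0..<n. real_of_int (A $$ (i, p i)))\<bar>"
    by (simp add: det_def'[OF A])
  also have "\<dots> \<le> (\<Sum>p | p permutes {0..<n}. B ^ n)"
  proof (rule order_trans[OF sum_abs], rule sum_mono)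
    fix p assume "p \<in> {p. p permutes {0..<n}}"
    then have p: "p permutes {0..<n}" by simp
    have "(\<Prod>i = 0..<n. \<bar>real_of_int (A $$ (i, p i))\<bar>) \<le> (\<Prod>i = 0..<n. B)"
      using B permutes_in_image[OF p] by (intro prod_mono) auto
    then show "\<bar>real_of_int (signof p) * (\<Prod>i = 0..<n. real_of_int (A $$ (i, p i)))\<bar> \<le> B ^ n"
      by (simp add: abs_mult abs_prod sign_def)
  qed
  also have "\<dots> = fact n * B ^ n" by (simp add: card_permutations[OF refl])
  finally show ?thesis .
qed

text \<open>Multiplication by \<xi> creates at most one term in \<open>\<xi> ^ s\<close>; one factor
  \<open>coeff p s\<close> per step allows the equation to replace it by lower powers with integer
  coefficients.\<close>

lemma algebraic_powers_reduce:
  fixes \<xi> :: real and p :: "int poly"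
  assumes root: "int_poly_eval p \<xi> = 0" and s: "degree p = s" "s > 0"
  shows "\<exists>r. of_int (coeff p s) ^ k * \<xi> ^ k = (\<Sum>j<s. real_of_int (r j) * \<xi> ^ j)"
proof (induction k)
  case 0
  have "(\<Sum>j<s. real_of_int (if j = 0 then 1 else 0) * \<xi> ^ j) = (\<Sum>j\<in>{0::nat}. 1)"
    using s by (intro sum.mono_neutral_cong_right) auto
  then show ?case by (intro exI[of _ "\<lambda>j. if j = 0 then 1 else 0"]) simp
next
  case (Suc k)
  then obtain r where r: "of_int (coeff p s) ^ k * \<xi> ^ k = (\<Sum>j<s. real_of_int (r j) * \<xi> ^ j)" ..
  define a where "a = real_of_int (coeff p s)"
  obtain t where t: "s = Suc t" using s(2) by (cases s) auto
  have top: "a * \<xi> ^ s = - (\<Sum>j<s. real_of_int (coeff p j) * \<xi> ^ j)"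
    using root s(1) unfolding int_poly_eval_altdef[OF order_refl]
    by (simp add: a_def lessThan_Suc_atMost[symmetric])
  \<comment> \<open>The first part shifts by one power and scales by the leading coefficient; the
    second accounts for the top term rewritten by the equation.\<close>
  define r' where "r' = (\<lambda>j. (case j of 0 \<Rightarrow> 0 | Suc i \<Rightarrow> coeff p s * r i) - r t * coeff p j)"
  have "a ^ Suc k * \<xi> ^ Suc k = a * \<xi> * (\<Sum>j<Suc t. real_of_int (r j) * \<xi> ^ j)"
    using r by (simp add: a_def t mult_ac)
  also have "\<dots> = (\<Sum>j<t. a * real_of_int (r j) * \<xi> ^ Suc j) + real_of_int (r t) * (a * \<xi> ^ s)"
    by (simp add: t algebra_simps sum_distrib_left)
  also have "(\<Sum>j<t. a * real_of_int (r j) * \<xi> ^ Suc j)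
      = (\<Sum>j<s. real_of_int (case j of 0 \<Rightarrow> 0 | Suc i \<Rightarrow> coeff p s * r i) * \<xi> ^ j)"
    unfolding t sum.lessThan_Suc_shift by (simp add: a_def t)
  finally have "a ^ Suc k * \<xi> ^ Suc k = (\<Sum>j<s. real_of_int (r' j) * \<xi> ^ j)"
    unfolding top r'_def
    by (simp add: algebra_simps sum_subtractf sum_distrib_left)
  then show ?case unfolding a_def by blast
qed

text \<open>In place of conjugates, multiplication by the scaled value is written as an integer
  matrix. Its determinant is a nonzero integer, and it equals the scaled value times a combination
  of cofactors, which grow like \<open>poly_l1 Q\<close> to the degree of \<xi> minus one. The
  exponent precedes \<open>N\<close> so that a caller may choose \<open>N\<close> in terms of
  it.\<close>

lemma algebraic_poly_lower_bound:
  fixes \<xi> :: real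
  assumes "algebraic \<xi>"
  shows "\<exists>s. \<forall>N. \<exists>\<kappa>>0. \<forall>Q. degree Q \<le> N \<longrightarrow> int_poly_eval Q \<xi> \<noteq> 0 \<longrightarrow>
    \<kappa> \<le> \<bar>int_poly_eval Q \<xi>\<bar> * poly_l1 Q ^ s"
proof -
  have "\<exists>p. p \<noteq> 0 \<and> int_poly_eval p \<xi> = 0"
    using algebraicE'[OF assms] by metis
  \<comment> \<open>Least degree plays the part of a minimal polynomial: no nonzero integer
    polynomial of smaller degree vanishes at \<xi>.\<close>
  then obtain p where p: "p \<noteq> 0" "int_poly_eval p \<xi> = 0"
    and min: "\<And>v. v \<noteq> 0 \<Longrightarrow> int_poly_eval v \<xi> = 0 \<Longrightarrow> degree p \<le> degree v"
    using ex_has_least_nat[of "\<lambda>p. p \<noteq> 0 \<and> int_poly_eval p \<xi> = 0" _ degree] by blast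
  define s where "s = degree p"
  define a where "a = coeff p s"
  have "a \<noteq> 0" using p by (simp add: a_def s_def)
  have "s > 0"
  proof (rule ccontr)
    assume "\<not> s > 0"
    then have "int_poly_eval p \<xi> = of_int (coeff p 0)"
      using int_poly_eval_altdef[of p 0 \<xi>] by (simp add: s_def)
    then show False using p \<open>a \<noteq> 0\<close> \<open>\<not> s > 0\<close> by (simp add: a_def)
  qed
  obtain r where r: "\<And>k. of_int a ^ k * \<xi> ^ k = (\<Sum>j<s. real_of_int (r k j) * \<xi> ^ j)"
    using algebraic_powers_reduce[OF p(2) s_def[symmetric] \<open>s > 0\<close>] unfolding a_def by metis
  have "\<exists>\<kappa>>0. \<forall>Q. degree Q \<le> N \<longrightarrow> int_poly_eval Q \<xi> \<noteq> 0 \<longrightarrow>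
    \<kappa> \<le> \<bar>int_poly_eval Q \<xi>\<bar> * poly_l1 Q ^ (s - 1)" for N
  proof -
    \<comment> \<open>The matrix below involves the powers \<open>i + k\<close> with
      \<open>i \<le> N\<close> and \<open>k < s\<close>, so \<open>a ^ d\<close> clears all of them
      at once.\<close>
    define d where "d = N + s"
    define R where "R = (\<lambda>k j. a ^ (d - k) * r k j)"
    have R: "of_int a ^ d * \<xi> ^ k = (\<Sum>j<s. real_of_int (R k j) * \<xi> ^ j)" if "k \<le> d" for k
    proof -
      have "of_int a ^ d * \<xi> ^ k = of_int a ^ (d - k) * (of_int a ^ k * \<xi> ^ k)"
        using that by (simp flip: power_add mult.assoc)
      then show ?thesis unfolding r by (simp add: R_def sum_distrib_left mult_ac)
    qed
    define C where "C = (\<Sum>k\<le>d. \<Sum>j<s. \<bar>real_of_int (R k j)\<bar>)"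
    have C: "\<bar>real_of_int (R k j)\<bar> \<le> C" if "k \<le> d" "j < s" for k j
    proof -
      have "\<bar>real_of_int (R k j)\<bar> \<le> (\<Sum>j<s. \<bar>real_of_int (R k j)\<bar>)"
        using that by (intro member_le_sum) auto
      also have "\<dots> \<le> C" unfolding C_def
        using that by (intro member_le_sum[where f = "\<lambda>k. \<Sum>j<s. \<bar>real_of_int (R k j)\<bar>"]) (auto intro: sum_nonneg)
      finally show ?thesis .
    qed
    have "C \<ge> 0" unfolding C_def by (intro sum_nonneg) auto
    \<comment> \<open>Collects what is independent of \<open>Q\<close>: the scaling by
      \<open>a ^ d\<close>, the Leibniz bound for a cofactor, and the powers of \<xi>.\<close>
    define E where "E = \<bar>real_of_int a\<bar> ^ d * (fact (s - 1) * C ^ (s - 1) * (\<Sum>k<s. \<bar>\<xi>\<bar> ^ k))"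
    have main: "1 \<le> E * (\<bar>int_poly_eval Q \<xi>\<bar> * poly_l1 Q ^ (s - 1))"
      if Q: "degree Q \<le> N" "int_poly_eval Q \<xi> \<noteq> 0" for Q
    proof -
      \<comment> \<open>\<open>M\<close> is multiplication by \<open>a ^ d * Q \<xi>\<close> in the basis \<open>1, \<xi>, \<dots>, \<xi> ^ (s - 1)\<close>.\<close>
      define M where "M = mat s s (\<lambda>(k, j). \<Sum>i\<le>N. coeff Q i * R (i + k) j)"
      have M: "M \<in> carrier_mat s s" by (simp add: M_def)
      define e where "e = of_int a ^ d * int_poly_eval Q \<xi>"
      have "e \<noteq> 0" using \<open>a \<noteq> 0\<close> Q by (simp add: e_def)
      have eig: "(\<Sum>j<s. real_of_int (M $$ (k, j)) * \<xi> ^ j) = e * \<xi> ^ k" if "k < s" for k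
      proof -
        have "(\<Sum>j<s. real_of_int (M $$ (k, j)) * \<xi> ^ j) =
            (\<Sum>j<s. \<Sum>i\<le>N. real_of_int (coeff Q i) * (real_of_int (R (i + k) j) * \<xi> ^ j))"
          using that by (simp add: M_def sum_distrib_right sum_distrib_left mult_ac)
        also have "\<dots> = (\<Sum>i\<le>N. \<Sum>j<s. real_of_int (coeff Q i) * (real_of_int (R (i + k) j) * \<xi> ^ j))"
          by (rule sum.swap)
        also have "\<dots> = (\<Sum>i\<le>N. real_of_int (coeff Q i) * (of_int a ^ d * \<xi> ^ (i + k)))"
          unfolding sum_distrib_left[symmetric] using that
          by (intro sum.cong refl arg_cong2[where f = "(*)"] R[symmetric]) (simp add: d_def)
        also have "\<dots> = e * \<xi> ^ k"
          by (simp add: e_def int_poly_eval_altdef[OF Q(1)] sum_distrib_left sum_distrib_right power_add mult_ac)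
        finally show ?thesis .
      qed
      \<comment> \<open>A row vector annihilating \<open>M\<close>, paired with the eigenvector of
        powers of \<xi>, would give a nonzero integer polynomial of degree below \<open>s\<close>
        vanishing at \<xi>, against minimality.\<close>
      have "det M \<noteq> 0"
      proof
        assume "det M = 0"
        then have "det M\<^sup>T = 0" using det_transpose[OF M] by simp
        moreover have MT: "M\<^sup>T \<in> carrier_mat s s" using M by simp
        ultimately obtain x where x: "x \<in> carrier_vec s" "x \<noteq> 0\<^sub>v s" "M\<^sup>T *\<^sub>v x = 0\<^sub>v s"
          using det_0_iff_vec_prod_zero[OF MT] by blast
        have xM: "(\<Sum>k<s. M $$ (k, j) * x $ k) = 0" if "j < s" for j
        proof -
          have "(M\<^sup>T *\<^sub>v x) $ j = 0" using x(3) that by simp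
          then show ?thesis using that x(1) M by (simp add: scalar_prod_def lessThan_atLeast0)
        qed
        have "e * (\<Sum>k<s. real_of_int (x $ k) * \<xi> ^ k)
            = (\<Sum>k<s. real_of_int (x $ k) * (\<Sum>j<s. real_of_int (M $$ (k, j)) * \<xi> ^ j))"
          unfolding sum_distrib_left[of e] by (intro sum.cong refl) (simp add: eig)
        also have "\<dots> = (\<Sum>k<s. \<Sum>j<s. real_of_int (x $ k) * (real_of_int (M $$ (k, j)) * \<xi> ^ j))"
          by (simp only: sum_distrib_left)
        also have "\<dots> = (\<Sum>j<s. \<Sum>k<s. real_of_int (x $ k) * (real_of_int (M $$ (k, j)) * \<xi> ^ j))"
          by (rule sum.swap)
        also have "\<dots> = (\<Sum>j<s. real_of_int (\<Sum>k<s. M $$ (k, j) * x $ k) * \<xi> ^ j)"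
          by (simp add: sum_distrib_right sum_distrib_left mult_ac)
        also have "\<dots> = 0" by (simp add: xM)
        finally have x0: "(\<Sum>k<s. real_of_int (x $ k) * \<xi> ^ k) = 0" using \<open>e \<noteq> 0\<close> by simp
        obtain v where v: "degree v \<le> s - 1" "\<And>j. coeff v j = (if j \<le> s - 1 then x $ j else 0)"
          using poly_with_coeffs[of "s - 1" "\<lambda>j. x $ j"] by auto
        have "{..s - 1} = {..<s}" using \<open>s > 0\<close> by auto
        then have "int_poly_eval v \<xi> = (\<Sum>k<s. real_of_int (x $ k) * \<xi> ^ k)"
          unfolding int_poly_eval_altdef[OF v(1)] by (intro sum.cong) (auto simp: v(2))
        then have "int_poly_eval v \<xi> = 0" using x0 by simp
        moreover have "v \<noteq> 0"
        proof
          assume "v = 0"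
          then have "x $ j = 0" if "j < s" for j using v(2)[of j] that by (auto split: if_splits)
          then show False using x(1,2) by (auto simp: vec_eq_iff)
        qed
        ultimately have "s \<le> degree v" using min s_def by blast
        then show False using v(1) \<open>s > 0\<close> by simp
      qed
      \<comment> \<open>The cofactors of column 0 form a row of the adjugate; multiplied by
        \<open>M\<close> they isolate the coordinate 0, where the eigenvector has the entry
        1.\<close>
      have adj: "(\<Sum>k<s. cofactor M k 0 * M $$ (k, j)) = (if j = 0 then det M else 0)" if "j < s" for j
      proof -
        have "(adj_mat M * M) $$ (0, j) = (det M \<cdot>\<^sub>m 1\<^sub>m s) $$ (0, j)" using adj_mat(3)[OF M] by simp
        then show ?thesis
          using that M \<open>s > 0\<close> by (simp add: adj_mat_def scalar_prod_def lessThan_atLeast0)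
      qed
      have "real_of_int (det M) = (\<Sum>j<s. real_of_int (if j = 0 then det M else 0) * \<xi> ^ j)"
      proof -
        have "(\<Sum>j<s. real_of_int (if j = 0 then det M else 0) * \<xi> ^ j) = (\<Sum>j\<in>{0::nat}. real_of_int (det M))"
          using \<open>s > 0\<close> by (intro sum.mono_neutral_cong_right) auto
        then show ?thesis by simp
      qed
      also have "\<dots> = (\<Sum>j<s. real_of_int (\<Sum>k<s. cofactor M k 0 * M $$ (k, j)) * \<xi> ^ j)"
        by (intro sum.cong refl) (simp add: adj)
      also have "\<dots> = (\<Sum>j<s. \<Sum>k<s. real_of_int (cofactor M k 0) * (real_of_int (M $$ (k, j)) * \<xi> ^ j))"
        by (simp add: sum_distrib_right sum_distrib_left mult_ac)
      also have "\<dots> = (\<Sum>k<s. \<Sum>j<s. real_of_int (cofactor M k 0) * (real_of_int (M $$ (k, j)) * \<xi> ^ j))"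
        by (rule sum.swap)
      also have "\<dots> = (\<Sum>k<s. real_of_int (cofactor M k 0) * (e * \<xi> ^ k))"
        unfolding sum_distrib_left[symmetric] by (intro sum.cong refl) (simp add: eig)
      also have "\<dots> = e * (\<Sum>k<s. real_of_int (cofactor M k 0) * \<xi> ^ k)"
        by (simp add: sum_distrib_left mult_ac)
      finally have det_eq: "real_of_int (det M) = e * (\<Sum>k<s. real_of_int (cofactor M k 0) * \<xi> ^ k)" .
      have Mb: "\<bar>real_of_int (M $$ (k, j))\<bar> \<le> C * poly_l1 Q" if "k < s" "j < s" for k j
      proof -
        have "\<bar>real_of_int (M $$ (k, j))\<bar> \<le> (\<Sum>i\<le>N. \<bar>real_of_int (coeff Q i)\<bar> * \<bar>real_of_int (R (i + k) j)\<bar>)"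
          using that by (simp add: M_def flip: abs_mult)
        also have "\<dots> \<le> (\<Sum>i\<le>N. \<bar>real_of_int (coeff Q i)\<bar> * C)"
          using that by (intro sum_mono mult_left_mono C) (auto simp: d_def)
        also have "\<dots> = C * poly_l1 Q" by (simp add: poly_l1_eq[OF Q(1)] sum_distrib_left mult_ac)
        finally show ?thesis .
      qed
      have cof: "\<bar>real_of_int (cofactor M k 0)\<bar> \<le> fact (s - 1) * (C * poly_l1 Q) ^ (s - 1)" if k: "k < s" for k
      proof -
        have "\<bar>real_of_int (det (mat_delete M k 0))\<bar> \<le> fact (s - 1) * (C * poly_l1 Q) ^ (s - 1)"
        proof (rule abs_det_le)
          show "mat_delete M k 0 \<in> carrier_mat (s - 1) (s - 1)" using mat_delete_carrier[OF M] .
          fix i j assume "i < s - 1" "j < s - 1"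
          then show "\<bar>real_of_int (mat_delete M k 0 $$ (i, j))\<bar> \<le> C * poly_l1 Q"
            using M by (auto simp: mat_delete_def intro!: Mb)
        qed
        then show ?thesis by (simp add: cofactor_def abs_mult)
      qed
      have "1 \<le> \<bar>real_of_int (det M)\<bar>" using \<open>det M \<noteq> 0\<close> by linarith
      also have "\<dots> = \<bar>e\<bar> * \<bar>\<Sum>k<s. real_of_int (cofactor M k 0) * \<xi> ^ k\<bar>" by (simp add: det_eq abs_mult)
      also have "\<dots> \<le> \<bar>e\<bar> * (\<Sum>k<s. fact (s - 1) * (C * poly_l1 Q) ^ (s - 1) * \<bar>\<xi>\<bar> ^ k)"
      proof (intro mult_left_mono order_trans[OF sum_abs] sum_mono)
        fix k assume "k \<in> {..<s}"
        then have "k < s" by simp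
        from mult_right_mono[OF cof[OF this], of "\<bar>\<xi>\<bar> ^ k"]
        show "\<bar>real_of_int (cofactor M k 0) * \<xi> ^ k\<bar> \<le> fact (s - 1) * (C * poly_l1 Q) ^ (s - 1) * \<bar>\<xi>\<bar> ^ k"
          by (simp add: abs_mult power_abs)
      qed simp
      also have "\<dots> = E * (\<bar>int_poly_eval Q \<xi>\<bar> * poly_l1 Q ^ (s - 1))"
        unfolding sum_distrib_left[symmetric] E_def e_def
        by (simp add: abs_mult power_abs power_mult_distrib mult_ac)
      finally show ?thesis .
    qed
    \<comment> \<open>Only nonnegativity of \<open>E\<close> is at hand, hence the constant
      \<open>1 / (E + 1)\<close>.\<close>
    have "E \<ge> 0" using \<open>C \<ge> 0\<close> by (simp add: E_def sum_nonneg)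
    then have "1 / (E + 1) \<le> \<bar>int_poly_eval Q \<xi>\<bar> * poly_l1 Q ^ (s - 1)"
      if "degree Q \<le> N" "int_poly_eval Q \<xi> \<noteq> 0" for Q
    proof -
      let ?x = "\<bar>int_poly_eval Q \<xi>\<bar> * poly_l1 Q ^ (s - 1)"
      have "0 \<le> ?x" by (simp add: poly_l1_nonneg)
      then have "1 \<le> (E + 1) * ?x" using main[OF that] by (simp add: algebra_simps)
      then show ?thesis using \<open>E \<ge> 0\<close> by (simp add: divide_le_eq mult.commute)
    qed
    then show ?thesis using \<open>E \<ge> 0\<close> by (intro exI[of _ "1 / (E + 1)"]) auto
  qed
  then show ?thesis by blast
qed

section \<open>Iterating the functional equation\<close>

lemma int_poly_eval_add: "int_poly_eval (P + Q) z = int_poly_eval P z + int_poly_eval Q z"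
proof -
  have "(map_poly of_int (P + Q) :: 'a poly) = map_poly of_int P + map_poly of_int Q"
    by (rule poly_eqI) (simp add: coeff_map_poly)
  then show ?thesis by simp
qed

lemma int_poly_eval_smult: "int_poly_eval (smult a P) z = of_int a * int_poly_eval P z"
proof -
  have "(map_poly of_int (smult a P) :: 'a poly) = smult (of_int a) (map_poly of_int P)"
    by (rule poly_eqI) (simp add: coeff_map_poly)
  then show ?thesis by simp
qed

lemma int_poly_eval_pCons: "int_poly_eval (pCons a P) z = of_int a + z * int_poly_eval P z"
  by (simp add: map_poly_pCons)

lemma int_poly_eval_mult: "int_poly_eval (P * Q) z = int_poly_eval P z * int_poly_eval Q z"
  by (induction P)
    (simp_all add: mult_pCons_left int_poly_eval_add int_poly_eval_smult int_poly_eval_pCons algebra_simps)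

lemma int_poly_eval_power: "int_poly_eval (P ^ k) z = int_poly_eval P z ^ k"
  by (induction k) (simp_all add: int_poly_eval_mult)

lemma int_poly_eval_sum: "int_poly_eval (\<Sum>j\<in>J. P j) z = (\<Sum>j\<in>J. int_poly_eval (P j) z)"
  by (induction J rule: infinite_finite_induct) (simp_all add: int_poly_eval_add)

text \<open>The exponent \<open>L\<close> may exceed the degree, so that several polynomials can be
  cleared by the same power of \<open>X\<close>.\<close>

lemma int_poly_eval_inverse_scaled:
  assumes "degree P \<le> L" "X > 0"
  shows "\<exists>y::int. of_int y = real X ^ L * int_poly_eval P (1 / real X) \<and>
    \<bar>real_of_int y\<bar> \<le> poly_l1 P * real X ^ L"
proof -
  define y where "y = (\<Sum>i\<le>L. coeff P i * int X ^ (L - i))"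
  have "real_of_int y = (\<Sum>i\<le>L. real X ^ L * (real_of_int (coeff P i) * (1 / real X) ^ i))"
    unfolding y_def of_int_sum
  proof (intro sum.cong refl)
    fix i assume "i \<in> {..L}"
    then have "real X ^ L = real X ^ (L - i) * real X ^ i" by (simp flip: power_add)
    then show "real_of_int (coeff P i * int X ^ (L - i)) = real X ^ L * (real_of_int (coeff P i) * (1 / real X) ^ i)"
      using assms(2) by (simp add: power_divide)
  qed
  then have y: "real_of_int y = real X ^ L * int_poly_eval P (1 / real X)"
    by (simp add: int_poly_eval_altdef[OF assms(1)] sum_distrib_left)
  have "\<bar>int_poly_eval P (1 / real X)\<bar> \<le> poly_l1 P"
    using int_poly_eval_bound[of "1 / real X" P] assms(2) by simp
  then have "real X ^ L * \<bar>int_poly_eval P (1 / real X)\<bar> \<le> real X ^ L * poly_l1 P"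
    by (intro mult_left_mono) auto
  then have "\<bar>real_of_int y\<bar> \<le> poly_l1 P * real X ^ L"
    by (simp add: y abs_mult mult.commute)
  with y show ?thesis by blast
qed

text \<open>The exponent \<open>K\<close> survives the induction: one more step at worst squares the
  bound, and the square of b^(d^m) is at most b^(d^(m+1)) because d is at least 2.\<close>

lemma functional_equation_iterate:
  fixes \<xi> :: "nat \<Rightarrow> real"
  assumes "d \<ge> 2" "b \<ge> 2"
    and step: "\<And>m. \<exists>s t u :: int. s \<noteq> 0 \<and> t \<noteq> 0 \<and> of_int s * \<xi> m = of_int u + of_int t * \<xi> (Suc m) \<and>
      \<bar>real_of_int s\<bar> \<le> (real b ^ d ^ m) ^ K \<and> \<bar>real_of_int t\<bar> \<le> (real b ^ d ^ m) ^ K"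
  shows "\<exists>S T U :: int. S \<noteq> 0 \<and> T \<noteq> 0 \<and> of_int S * \<xi> 0 = of_int U + of_int T * \<xi> m \<and>
      \<bar>real_of_int S\<bar> \<le> (real b ^ d ^ m) ^ K \<and> \<bar>real_of_int T\<bar> \<le> (real b ^ d ^ m) ^ K"
proof (induction m)
  case 0
  have "1 \<le> (real b ^ d ^ 0) ^ K" using assms by (intro one_le_power) simp
  then show ?case by (intro exI[of _ 1] exI[of _ 0]) simp
next
  case (Suc m)
  then obtain S T U where ST: "S \<noteq> 0" "T \<noteq> 0" "of_int S * \<xi> 0 = of_int U + of_int T * \<xi> m"
    "\<bar>real_of_int S\<bar> \<le> (real b ^ d ^ m) ^ K" "\<bar>real_of_int T\<bar> \<le> (real b ^ d ^ m) ^ K" by blast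
  obtain s t u where st: "s \<noteq> 0" "t \<noteq> 0" "of_int s * \<xi> m = of_int u + of_int t * \<xi> (Suc m)"
    "\<bar>real_of_int s\<bar> \<le> (real b ^ d ^ m) ^ K" "\<bar>real_of_int t\<bar> \<le> (real b ^ d ^ m) ^ K"
    using step[of m] by blast
  have "(real b ^ d ^ m) ^ K * (real b ^ d ^ m) ^ K = ((real b ^ d ^ m) ^ 2) ^ K"
    by (simp add: power2_eq_square power_mult_distrib)
  also have "(real b ^ d ^ m) ^ 2 \<le> real b ^ d ^ Suc m"
    using assms by (simp add: mult.commute power_increasing flip: power_mult)
  then have "((real b ^ d ^ m) ^ 2) ^ K \<le> (real b ^ d ^ Suc m) ^ K"
    by (intro power_mono) auto
  finally have grow: "(real b ^ d ^ m) ^ K * (real b ^ d ^ m) ^ K \<le> (real b ^ d ^ Suc m) ^ K" .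
  have "\<bar>real_of_int (s * S)\<bar> \<le> (real b ^ d ^ m) ^ K * (real b ^ d ^ m) ^ K"
    unfolding of_int_mult abs_mult using ST st by (intro mult_mono) auto
  moreover have "\<bar>real_of_int (T * t)\<bar> \<le> (real b ^ d ^ m) ^ K * (real b ^ d ^ m) ^ K"
    unfolding of_int_mult abs_mult using ST st by (intro mult_mono) auto
  moreover have "of_int (s * S) * \<xi> 0 = of_int (s * U + T * u) + of_int (T * t) * \<xi> (Suc m)"
  proof -
    have "of_int (s * S) * \<xi> 0 = of_int s * (of_int S * \<xi> 0)" by simp
    also have "\<dots> = of_int (s * U) + of_int T * (of_int s * \<xi> m)"
      unfolding ST(3) by (simp add: algebra_simps)
    finally show ?thesis unfolding st(3) by (simp add: algebra_simps)
  qed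
  moreover have "s * S \<noteq> 0" "T * t \<noteq> 0" using ST st by auto
  ultimately show ?case using grow by (meson order_trans)
qed

lemma functional_equation_step:
  fixes A B C D :: "int poly" and \<xi> :: "nat \<Rightarrow> real"
  assumes "d \<ge> 2" "b \<ge> 2"
    and eq: "\<And>m. \<xi> m = int_poly_eval A (1 / real b ^ d ^ m) / int_poly_eval B (1 / real b ^ d ^ m)
        + int_poly_eval C (1 / real b ^ d ^ m) / int_poly_eval D (1 / real b ^ d ^ m) * \<xi> (Suc m)"
    and nonvan: "\<And>m. int_poly_eval B (1 / real b ^ d ^ m) * int_poly_eval C (1 / real b ^ d ^ m)
        * int_poly_eval D (1 / real b ^ d ^ m) \<noteq> 0"
  shows "\<exists>K. \<forall>m. \<exists>s t u :: int. s \<noteq> 0 \<and> t \<noteq> 0 \<and> of_int s * \<xi> m = of_int u + of_int t * \<xi> (Suc m) \<and>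
      \<bar>real_of_int s\<bar> \<le> (real b ^ d ^ m) ^ K \<and> \<bar>real_of_int t\<bar> \<le> (real b ^ d ^ m) ^ K"
proof -
  define L where "L = max (degree (B * D)) (max (degree (A * D)) (degree (B * C)))"
  \<comment> \<open>The lengths are rounded up to an integer that serves as an exponent: a factor at
    most \<open>W\<close> is absorbed because W <= 2^W <= X^W.\<close>
  define W where "W = nat \<lceil>poly_l1 (B * D) + poly_l1 (B * C)\<rceil>"
  have "\<exists>s t u :: int. s \<noteq> 0 \<and> t \<noteq> 0 \<and> of_int s * \<xi> m = of_int u + of_int t * \<xi> (Suc m) \<and>
      \<bar>real_of_int s\<bar> \<le> (real b ^ d ^ m) ^ (W + L) \<and> \<bar>real_of_int t\<bar> \<le> (real b ^ d ^ m) ^ (W + L)" for m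
  proof -
    define X where "X = b ^ d ^ m"
    have X: "real b ^ d ^ m = real X" by (simp add: X_def)
    have "X \<ge> b" using assms by (simp add: X_def self_le_power)
    then have "X \<ge> 2" using assms by simp
    define x where "x = 1 / real X"
    have deg: "degree (B * D) \<le> L" "degree (B * C) \<le> L" "degree (A * D) \<le> L"
      by (simp_all only: L_def max.cobounded1 max.cobounded2 max.coboundedI2)
    have "X > 0" using \<open>X \<ge> 2\<close> by simp
    obtain s where s: "of_int s = real X ^ L * int_poly_eval (B * D) x" "\<bar>real_of_int s\<bar> \<le> poly_l1 (B * D) * real X ^ L"
      using int_poly_eval_inverse_scaled[OF deg(1) \<open>X > 0\<close>] unfolding x_def by blast
    obtain t where t: "of_int t = real X ^ L * int_poly_eval (B * C) x" "\<bar>real_of_int t\<bar> \<le> poly_l1 (B * C) * real X ^ L"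
      using int_poly_eval_inverse_scaled[OF deg(2) \<open>X > 0\<close>] unfolding x_def by blast
    obtain u where u: "of_int u = real X ^ L * int_poly_eval (A * D) x"
      using int_poly_eval_inverse_scaled[OF deg(3) \<open>X > 0\<close>] unfolding x_def by blast
    have nz: "int_poly_eval B x \<noteq> 0" "int_poly_eval C x \<noteq> 0" "int_poly_eval D x \<noteq> 0"
      using nonvan[of m] by (auto simp: X x_def)
    \<comment> \<open>Clearing with \<open>B * D\<close> leaves the coefficients
      \<open>B * D\<close> and \<open>B * C\<close>, whose values are nonzero by hypothesis.\<close>
    have "int_poly_eval (B * D) x * \<xi> m = int_poly_eval (A * D) x + int_poly_eval (B * C) x * \<xi> (Suc m)"
      unfolding eq[of m] X x_def[symmetric] int_poly_eval_mult using nz by (simp add: field_simps)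
    then have "of_int s * \<xi> m = of_int u + of_int t * \<xi> (Suc m)"
      unfolding s(1) t(1) u by (simp only: mult.assoc distrib_left)
    moreover have "of_int s \<noteq> (0::real)" "of_int t \<noteq> (0::real)"
      unfolding s(1) t(1) int_poly_eval_mult using nz \<open>X \<ge> 2\<close> by auto
    moreover have big: "v * real X ^ L \<le> real X ^ (W + L)" if "v \<le> real W" for v
    proof -
      have "W \<le> 2 ^ W" by (rule less_imp_le[OF less_exp])
      also have "\<dots> \<le> X ^ W" using \<open>X \<ge> 2\<close> by (rule power_mono) simp
      finally have "real W \<le> real X ^ W" by (metis of_nat_le_iff of_nat_power)
      with that have "v \<le> real X ^ W" by (rule order_trans)
      then have "v * real X ^ L \<le> real X ^ W * real X ^ L" by (rule mult_right_mono) simp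
      then show ?thesis by (simp only: power_add)
    qed
    have "poly_l1 (B * D) \<le> real W" "poly_l1 (B * C) \<le> real W"
      using poly_l1_nonneg[of "B * D"] poly_l1_nonneg[of "B * C"] unfolding W_def by linarith+
    then have "\<bar>real_of_int s\<bar> \<le> real X ^ (W + L)" "\<bar>real_of_int t\<bar> \<le> real X ^ (W + L)"
      using big s(2) t(2) by (meson order_trans)+
    ultimately show ?thesis unfolding X by auto
  qed
  then show ?thesis by blast
qed

lemma inverse_tower_tendsto_0:
  assumes "d \<ge> 2" "b \<ge> 2"
  shows "(\<lambda>m. 1 / real b ^ d ^ m) \<longlonglongrightarrow> 0"
proof (rule tendsto_sandwich[OF _ _ tendsto_const])
  show "\<forall>\<^sub>F m in sequentially. 1 / real b ^ d ^ m \<le> (1 / 2) ^ m"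
  proof (intro always_eventually allI)
    fix m
    have "m \<le> d ^ m" using assms less_imp_le[OF less_exp[of m]] power_mono[of 2 d m] by linarith
    then have "real b ^ m \<le> real b ^ d ^ m" using assms by (intro power_increasing) auto
    moreover have "(2::real) ^ m \<le> real b ^ m" using assms by (intro power_mono) auto
    ultimately have "(2::real) ^ m \<le> real b ^ d ^ m" by linarith
    then show "1 / real b ^ d ^ m \<le> (1 / 2) ^ m"
      by (simp add: power_divide frac_le)
  qed
  show "(\<lambda>m. (1 / 2 :: real) ^ m) \<longlonglongrightarrow> 0" by (rule LIMSEQ_power_zero) simp
qed simp

section \<open>Mahler's method\<close>

text \<open>The pair \<open>(j, l)\<close> indexing the coefficient of \<open>z ^ l\<close> in \<open>P j\<close> is encoded as \<open>j * (N + 1) + l\<close>.\<close>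

lemma auxiliary_polynomials:
  fixes F :: "int fps"
  shows "\<exists>P. (\<forall>j. degree (P j) \<le> N) \<and> (\<exists>j\<le>N. P j \<noteq> 0) \<and>
    (\<forall>i<N\<^sup>2. fps_nth (\<Sum>j\<le>N. fps_of_poly (P j) * F ^ j) i = 0)"
proof -
  define n where "n = Suc N"
  define v where "v = (\<lambda>i k. fps_nth (fps_of_poly (monom 1 (k mod n)) * F ^ (k div n)) i)"
  \<comment> \<open>The (N + 1)^2 unknown coefficients face N^2 vanishing conditions.\<close>
  have "N\<^sup>2 < n * n" by (simp add: n_def power2_eq_square)
  then obtain x where x: "\<exists>k<n * n. x k \<noteq> 0" "\<And>i. i < N\<^sup>2 \<Longrightarrow> (\<Sum>k<n * n. v i k * x k) = 0"
    using int_homogeneous_solution[of "N\<^sup>2" "n * n" v] by blast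
  define P where "P = (\<lambda>j. \<Sum>l<n. monom (x (j * n + l)) l)"
  have coeff_P: "coeff (P j) l = (if l < n then x (j * n + l) else 0)" for j l
    by (auto simp: P_def coeff_sum)
  have "degree (P j) \<le> N" for j
    by (rule degree_le) (auto simp: coeff_P n_def)
  moreover have "\<exists>j\<le>N. P j \<noteq> 0"
  proof -
    obtain k where k: "k < n * n" "x k \<noteq> 0" using x(1) by blast
    then have "k div n < n" by (simp add: less_mult_imp_div_less)
    moreover have "coeff (P (k div n)) (k mod n) \<noteq> 0"
      using k unfolding coeff_P div_mult_mod_eq by (simp add: n_def)
    ultimately show ?thesis by (intro exI[of _ "k div n"]) (auto simp: n_def)
  qed
  moreover have "fps_nth (\<Sum>j\<le>N. fps_of_poly (P j) * F ^ j) i = 0" if "i < N\<^sup>2" for i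
  proof -
    have P_sum: "fps_of_poly (P j) * F ^ j
        = (\<Sum>l<n. fps_const (x (j * n + l)) * (fps_of_poly (monom 1 l) * F ^ j))" for j
      by (simp add: P_def fps_of_poly_sum fps_of_poly_monom sum_distrib_right sum_distrib_left mult_ac)
    have "fps_nth (\<Sum>j\<le>N. fps_of_poly (P j) * F ^ j) i = (\<Sum>j<n. \<Sum>l<n. x (j * n + l) * v i (j * n + l))"
      unfolding P_sum fps_sum_nth fps_mult_left_const_nth
    proof (intro sum.cong refl)
      fix j l assume "l \<in> {..<n}"
      then have "(j * n + l) div n = j" "(j * n + l) mod n = l" by auto
      then show "x (j * n + l) * fps_nth (fps_of_poly (monom 1 l) * F ^ j) i = x (j * n + l) * v i (j * n + l)"
        by (simp only: v_def)
    qed (auto simp: n_def)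
    also have "\<dots> = (\<Sum>k<n * n. x k * v i k)"
    proof -
      have "(\<Sum>l<n. x (j * n + l) * v i (j * n + l)) = (\<Sum>k = j * n..<j * n + n. x k * v i k)" for j
        by (rule sum.reindex_bij_witness[of _ "\<lambda>k. k - j * n" "\<lambda>l. j * n + l"]) auto
      then show ?thesis by (simp only: sum.nat_group)
    qed
    also have "\<dots> = 0" using x(2)[OF that] by (simp add: mult.commute)
    finally show ?thesis .
  qed
  ultimately show ?thesis by blast
qed

text \<open>With X = b^(d^m), clearing denominators costs X^((K + 1) N), and Liouville's inequality
  costs the same \<open>s\<close> further times, while vanishing at 0 gains X^(N^2). The nonzero
  constant term of the cofactor \<open>G\<close> makes the value nonzero for large m.\<close>

lemma mahler_transcendental:
  fixes c :: "nat \<Rightarrow> int"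
  defines "F \<equiv> Abs_fps c"
  assumes d: "d \<ge> 2" and b: "b \<ge> 2"
    and F: "unit_disc_summable F"
    and hank: "\<And>g. \<exists>n>g. hankel_det c n \<noteq> 0"
    and \<xi>: "\<And>m. \<xi> m = pser (fps_nth F) (1 / real b ^ d ^ m)"
    and iter: "\<And>m. \<exists>S T U :: int. S \<noteq> 0 \<and> T \<noteq> 0 \<and> of_int S * \<xi> 0 = of_int U + of_int T * \<xi> m \<and>
      \<bar>real_of_int S\<bar> \<le> (real b ^ d ^ m) ^ K \<and> \<bar>real_of_int T\<bar> \<le> (real b ^ d ^ m) ^ K"
  shows "\<not> algebraic (\<xi> 0)"
proof
  assume "algebraic (\<xi> 0)"
  then obtain s where s: "\<And>N. \<exists>\<kappa>>0. \<forall>Q. degree Q \<le> N \<longrightarrow> int_poly_eval Q (\<xi> 0) \<noteq> 0 \<longrightarrow>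
    \<kappa> \<le> \<bar>int_poly_eval Q (\<xi> 0)\<bar> * poly_l1 Q ^ s"
    using algebraic_poly_lower_bound by blast
  \<comment> \<open>Chosen so that N^2 = (K + 1)(1 + s) N + N, which leaves \<open>x m ^ N\<close>
    after all losses.\<close>
  define N where "N = (K + 1) * (1 + s) + 1"
  obtain \<kappa> where "\<kappa> > 0" and \<kappa>: "\<And>Q. degree Q \<le> N \<Longrightarrow> int_poly_eval Q (\<xi> 0) \<noteq> 0 \<Longrightarrow>
    \<kappa> \<le> \<bar>int_poly_eval Q (\<xi> 0)\<bar> * poly_l1 Q ^ s" using s[of N] by blast
  obtain P where P: "\<And>j. degree (P j) \<le> N" "\<exists>j\<le>N. P j \<noteq> 0"
    "\<And>i. i < N\<^sup>2 \<Longrightarrow> fps_nth (\<Sum>j\<le>N. fps_of_poly (P j) * F ^ j) i = 0"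
    using auxiliary_polynomials[of N F] by blast
  define E where "E = (\<Sum>j\<le>N. fps_of_poly (P j) * F ^ j)"
  have E: "unit_disc_summable E"
    unfolding E_def
    by (intro unit_disc_summable_sum unit_disc_summable_mult unit_disc_summable_poly unit_disc_summable_power F)
  have "E \<noteq> 0"
    using fps_transcendental[OF F[unfolded F_def] hank, of P N] P(2) unfolding E_def F_def by blast
  define e where "e = subdegree E"
  obtain G where G: "fps_nth G 0 \<noteq> 0" "E = fps_X ^ e * G"
    using fps_factor_leading[OF \<open>E \<noteq> 0\<close>] unfolding e_def by blast
  have Gs: "unit_disc_summable G"
    using E unfolding G(2) by (rule unit_disc_summable_X_power_cancel)
  have "e \<ge> N\<^sup>2"
    using P(3) \<open>E \<noteq> 0\<close> unfolding e_def E_def[symmetric] by (meson nth_subdegree_nonzero not_le)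
  define x where "x = (\<lambda>m. 1 / real b ^ d ^ m)"
  have x0: "x \<longlonglongrightarrow> 0" unfolding x_def by (rule inverse_tower_tendsto_0[OF d b])
  have x_pos: "0 < x m" and x_half: "x m \<le> 1 / 2" for m
  proof -
    show "0 < x m" using b by (simp add: x_def)
    have "real b ^ 1 \<le> real b ^ d ^ m" using b d by (intro power_increasing) auto
    moreover have "2 \<le> real b" using b by simp
    ultimately have "2 \<le> real b ^ d ^ m" unfolding power_one_right by (rule order_trans[rotated])
    then show "x m \<le> 1 / 2" unfolding x_def by (intro divide_left_mono) (use b in auto)
  qed
  have x1: "norm (x m) < 1" for m using x_pos[of m] x_half[of m] by simp
  have \<xi>x: "\<xi> m = pser (fps_nth F) (x m)" for m by (simp add: \<xi> x_def)
  \<comment> \<open>The points tend to 0, so the values converge to the constant coefficient and are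
    bounded uniformly in m.\<close>
  have "Bseq \<xi>"
    unfolding \<xi>x using pser_tendsto_at_0[OF F x0] by (intro convergent_imp_Bseq convergentI)
  then obtain W0 where W0: "\<And>m. norm (\<xi> m) \<le> W0" by (auto simp: Bseq_def)
  define W where "W = max 1 W0"
  have W: "\<bar>\<xi> m\<bar> \<le> W" "W \<ge> 1" for m using W0[of m] by (auto simp: W_def)
  define \<Lambda> where "\<Lambda> = (\<Sum>j\<le>N. poly_l1 (P j))"
  have \<Lambda>: "poly_l1 (P j) \<le> \<Lambda>" if "j \<le> N" for j
    unfolding \<Lambda>_def using that by (intro member_le_sum) (auto simp: poly_l1_nonneg)
  have "\<Lambda> \<ge> 0" by (simp add: \<Lambda>_def sum_nonneg poly_l1_nonneg)
  define \<Gamma> where "\<Gamma> = (real N + 1) * \<Lambda> * (3 * W) ^ N"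
  have bound: "\<kappa> \<le> \<bar>pser (fps_nth G) (x m)\<bar> * \<Gamma> ^ s * x m" if Gm: "pser (fps_nth G) (x m) \<noteq> 0" for m
  proof -
    define X where "X = real b ^ d ^ m"
    have xX: "x m = 1 / X" by (simp add: x_def X_def)
    have "X > 0" using b by (simp add: X_def)
    have "X \<ge> 1" using x_half[of m] \<open>X > 0\<close> by (simp add: xX field_simps)
    obtain S T U where ST: "S \<noteq> 0" "T \<noteq> 0" "of_int S * \<xi> 0 = of_int U + of_int T * \<xi> m"
      "\<bar>real_of_int S\<bar> \<le> X ^ K" "\<bar>real_of_int T\<bar> \<le> X ^ K" unfolding X_def using iter[of m] by blast
    have U: "\<bar>real_of_int U\<bar> \<le> 2 * W * X ^ K"
    proof -
      have "real_of_int U = of_int S * \<xi> 0 - of_int T * \<xi> m" using ST(3) by simp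
      also have "\<bar>\<dots>\<bar> \<le> \<bar>of_int S * \<xi> 0\<bar> + \<bar>of_int T * \<xi> m\<bar>" by (rule abs_triangle_ineq4)
      also have "\<dots> \<le> X ^ K * W + X ^ K * W"
        unfolding abs_mult using ST W \<open>X > 0\<close> by (intro add_mono mult_mono) auto
      finally show ?thesis by simp
    qed
    \<comment> \<open>The iterated equation expresses T times \<open>\<xi> m\<close> as this linear
      polynomial at \<open>\<xi> 0\<close>.\<close>
    define R where "R = [:- U, S:]"
    have R_eval: "int_poly_eval R (\<xi> 0) = of_int T * \<xi> m"
      using ST(3) by (simp add: R_def int_poly_eval_pCons mult.commute)
    have R_l1: "poly_l1 R \<le> 3 * W * X ^ K"
    proof -
      have "poly_l1 R = \<bar>real_of_int U\<bar> + \<bar>real_of_int S\<bar>" by (simp add: R_def poly_l1_pCons poly_l1_0)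
      also have "\<dots> \<le> 2 * W * X ^ K + W * X ^ K"
      proof -
        have "1 * X ^ K \<le> W * X ^ K" using W(2) \<open>X > 0\<close> by (intro mult_right_mono) auto
        then show ?thesis using U ST(4) by linarith
      qed
      finally show ?thesis by simp
    qed
    have "\<exists>y::int. of_int y = X ^ N * int_poly_eval (P j) (x m) \<and> \<bar>real_of_int y\<bar> \<le> poly_l1 (P j) * X ^ N" for j
      using int_poly_eval_inverse_scaled[OF P(1)[of j], of "b ^ d ^ m"] b by (simp add: X_def x_def)
    then obtain y where y: "\<And>j. of_int (y j) = X ^ N * int_poly_eval (P j) (x m)"
      "\<And>j. \<bar>real_of_int (y j)\<bar> \<le> poly_l1 (P j) * X ^ N" by metis
    \<comment> \<open>Multiplying the auxiliary form by (X T)^N clears the powers of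
      \<open>x m\<close> and the denominator \<open>T\<close> of \<open>\<xi> m\<close>, which gives
      an integer polynomial at \<open>\<xi> 0\<close>.\<close>
    define Q where "Q = (\<Sum>j\<le>N. smult (y j * T ^ (N - j)) (R ^ j))"
    have "degree Q \<le> N"
      unfolding Q_def
    proof (rule degree_sum_le)
      fix j assume "j \<in> {..N}"
      have "degree R \<le> 1" by (simp add: R_def)
      have "degree (smult (y j * T ^ (N - j)) (R ^ j)) \<le> degree (R ^ j)" by (rule degree_smult_le)
      also have "\<dots> \<le> degree R * j" by (rule degree_power_le)
      also have "\<dots> \<le> 1 * j" using \<open>degree R \<le> 1\<close> by (rule mult_le_mono1)
      also have "\<dots> \<le> N" using \<open>j \<in> {..N}\<close> by simp
      finally show "degree (smult (y j * T ^ (N - j)) (R ^ j)) \<le> N" .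
    qed simp
    have "int_poly_eval Q (\<xi> 0) = (\<Sum>j\<le>N. X ^ N * of_int T ^ N * (int_poly_eval (P j) (x m) * \<xi> m ^ j))"
      unfolding Q_def int_poly_eval_sum int_poly_eval_smult int_poly_eval_power R_eval
    proof (intro sum.cong refl)
      fix j assume "j \<in> {..N}"
      then have "real_of_int T ^ N = of_int T ^ (N - j) * of_int T ^ j" by (simp flip: power_add)
      then show "of_int (y j * T ^ (N - j)) * (of_int T * \<xi> m) ^ j
          = X ^ N * of_int T ^ N * (int_poly_eval (P j) (x m) * \<xi> m ^ j)"
        by (simp add: y power_mult_distrib)
    qed
    also have "\<dots> = X ^ N * of_int T ^ N * (\<Sum>j\<le>N. int_poly_eval (P j) (x m) * \<xi> m ^ j)"
      by (simp only: sum_distrib_left)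
    also have "(\<Sum>j\<le>N. int_poly_eval (P j) (x m) * \<xi> m ^ j) = pser (fps_nth E) (x m)"
      unfolding E_def \<xi>x using x1 F
      by (subst pser_fps_sum)
        (auto simp: unit_disc_summable_mult unit_disc_summable_poly unit_disc_summable_power
          pser_fps_mult pser_fps_of_poly pser_fps_power)
    also have "\<dots> = x m ^ e * pser (fps_nth G) (x m)"
      unfolding G(2) by (rule pser_X_power_mult[OF Gs x1])
    finally have Q_eval: "int_poly_eval Q (\<xi> 0) = X ^ N * of_int T ^ N * (x m ^ e * pser (fps_nth G) (x m))" .
    have "int_poly_eval Q (\<xi> 0) \<noteq> 0"
      using Q_eval Gm x_pos[of m] ST(2) \<open>X > 0\<close> by simp
    then have low: "\<kappa> \<le> \<bar>int_poly_eval Q (\<xi> 0)\<bar> * poly_l1 Q ^ s"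
      by (rule \<kappa>[OF \<open>degree Q \<le> N\<close>])
    have Q_l1: "poly_l1 Q \<le> \<Gamma> * X ^ ((K + 1) * N)"
    proof -
      have "poly_l1 Q \<le> (\<Sum>j\<le>N. poly_l1 (smult (y j * T ^ (N - j)) (R ^ j)))"
        unfolding Q_def by (rule poly_l1_sum)
      also have "\<dots> \<le> (\<Sum>j\<le>N. \<Lambda> * (3 * W) ^ N * X ^ ((K + 1) * N))"
      proof (rule sum_mono)
        fix j assume "j \<in> {..N}"
        then have j: "j \<le> N" by simp
        have "poly_l1 (smult (y j * T ^ (N - j)) (R ^ j)) = \<bar>real_of_int (y j)\<bar> * \<bar>real_of_int T\<bar> ^ (N - j) * poly_l1 (R ^ j)"
          by (simp add: poly_l1_smult abs_mult power_abs)
        also have "\<dots> \<le> (\<Lambda> * X ^ N) * (X ^ K) ^ (N - j) * (3 * W * X ^ K) ^ j"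
        proof (intro mult_mono)
          show "\<bar>real_of_int (y j)\<bar> \<le> \<Lambda> * X ^ N"
            using y(2)[of j] \<Lambda>[OF j] \<open>X > 0\<close> by (meson mult_right_mono order_trans zero_le_power less_imp_le)
          show "\<bar>real_of_int T\<bar> ^ (N - j) \<le> (X ^ K) ^ (N - j)" using ST(5) by (intro power_mono) auto
          show "poly_l1 (R ^ j) \<le> (3 * W * X ^ K) ^ j"
            using poly_l1_power[of R j] power_mono[OF R_l1 poly_l1_nonneg, of j] by linarith
        qed (use \<open>\<Lambda> \<ge> 0\<close> \<open>X > 0\<close> poly_l1_nonneg in auto)
        also have "\<dots> = \<Lambda> * (3 * W) ^ j * (X ^ N * ((X ^ K) ^ (N - j) * (X ^ K) ^ j))"
          by (simp add: power_mult_distrib)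
        also have "(X ^ K) ^ (N - j) * (X ^ K) ^ j = X ^ (K * N)"
          using j by (simp flip: power_add power_mult add: add_mult_distrib2[symmetric])
        also have "X ^ N * X ^ (K * N) = X ^ ((K + 1) * N)"
          by (simp add: power_add[symmetric] add.commute)
        also have "\<Lambda> * (3 * W) ^ j * X ^ ((K + 1) * N) \<le> \<Lambda> * (3 * W) ^ N * X ^ ((K + 1) * N)"
          using j W(2) \<open>\<Lambda> \<ge> 0\<close> \<open>X > 0\<close> by (intro mult_right_mono mult_left_mono power_increasing) auto
        finally show "poly_l1 (smult (y j * T ^ (N - j)) (R ^ j)) \<le> \<Lambda> * (3 * W) ^ N * X ^ ((K + 1) * N)" .
      qed
      also have "\<dots> = \<Gamma> * X ^ ((K + 1) * N)" by (simp add: \<Gamma>_def)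
      finally show ?thesis .
    qed
    have "\<bar>int_poly_eval Q (\<xi> 0)\<bar> = X ^ N * \<bar>real_of_int T\<bar> ^ N * (x m ^ e * \<bar>pser (fps_nth G) (x m)\<bar>)"
      unfolding Q_eval using x_pos[of m] \<open>X > 0\<close> by (simp add: abs_mult power_abs)
    also have "\<dots> \<le> X ^ N * (X ^ K) ^ N * (x m ^ (N\<^sup>2) * \<bar>pser (fps_nth G) (x m)\<bar>)"
      using ST(5) \<open>X > 0\<close> x_pos[of m] x_half[of m] \<open>e \<ge> N\<^sup>2\<close>
      by (intro mult_mono power_mono mult_right_mono power_decreasing mult_nonneg_nonneg) auto
    also have "\<dots> = X ^ ((K + 1) * N) * x m ^ (N\<^sup>2) * \<bar>pser (fps_nth G) (x m)\<bar>"
      by (simp add: power_add power_mult)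
    finally have up: "\<bar>int_poly_eval Q (\<xi> 0)\<bar> \<le> X ^ ((K + 1) * N) * x m ^ (N\<^sup>2) * \<bar>pser (fps_nth G) (x m)\<bar>" .
    have "\<bar>int_poly_eval Q (\<xi> 0)\<bar> * poly_l1 Q ^ s \<le>
        (X ^ ((K + 1) * N) * x m ^ (N\<^sup>2) * \<bar>pser (fps_nth G) (x m)\<bar>) * (\<Gamma> * X ^ ((K + 1) * N)) ^ s"
      using up power_mono[OF Q_l1 poly_l1_nonneg] x_pos[of m] \<open>X > 0\<close>
      by (intro mult_mono) (auto simp: poly_l1_nonneg)
    also have "\<dots> = \<bar>pser (fps_nth G) (x m)\<bar> * \<Gamma> ^ s * (X ^ ((K + 1) * (1 + s) * N) * x m ^ (N\<^sup>2))"
      by (simp add: power_mult_distrib power_add[symmetric] power_mult[symmetric] algebra_simps)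
    also have "X ^ ((K + 1) * (1 + s) * N) * x m ^ (N\<^sup>2) = x m ^ N"
    proof -
      have "N\<^sup>2 = (K + 1) * (1 + s) * N + N" by (simp add: N_def power2_eq_square algebra_simps)
      then show ?thesis using \<open>X > 0\<close> by (simp only: xX power_add) (simp add: power_divide)
    qed
    also have "\<bar>pser (fps_nth G) (x m)\<bar> * \<Gamma> ^ s * x m ^ N \<le> \<bar>pser (fps_nth G) (x m)\<bar> * \<Gamma> ^ s * x m ^ 1"
    proof (rule mult_left_mono)
      show "x m ^ N \<le> x m ^ 1"
        using x_pos[of m] x_half[of m] by (intro power_decreasing) (auto simp: N_def)
      show "0 \<le> \<bar>pser (fps_nth G) (x m)\<bar> * \<Gamma> ^ s"
        using \<open>\<Lambda> \<ge> 0\<close> W(2) by (simp add: \<Gamma>_def)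
    qed
    finally show ?thesis using low by simp
  qed
  have G_lim: "(\<lambda>m. pser (fps_nth G) (x m)) \<longlonglongrightarrow> of_int (fps_nth G 0)"
    by (rule pser_tendsto_at_0[OF Gs x0])
  have "(\<lambda>m. \<bar>pser (fps_nth G) (x m)\<bar> * \<Gamma> ^ s * x m) \<longlonglongrightarrow> \<bar>of_int (fps_nth G 0)\<bar> * \<Gamma> ^ s * 0"
    by (intro tendsto_intros G_lim x0)
  moreover have "\<forall>\<^sub>F m in sequentially. \<kappa> \<le> \<bar>pser (fps_nth G) (x m)\<bar> * \<Gamma> ^ s * x m"
  proof -
    have "\<forall>\<^sub>F m in sequentially. pser (fps_nth G) (x m) \<noteq> 0"
      using G(1) by (intro tendsto_imp_eventually_ne[OF G_lim]) simp
    then show ?thesis by (rule eventually_mono) (rule bound)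
  qed
  ultimately have "\<kappa> \<le> \<bar>of_int (fps_nth G 0)\<bar> * \<Gamma> ^ s * 0"
    by (rule tendsto_lowerbound) simp
  then show False using \<open>\<kappa> > 0\<close> by simp
qed

section \<open>Irrationality exponents\<close>

text \<open>With X = b^(d^m) and x = 1/X, take q = X^n Q(x) S, for which q \<open>\<xi> 0\<close> -
  p = T X^n x^e G(x). For large m the values of \<open>Q\<close> and \<open>G\<close> are at most
  \<open>X\<close>, which is the 1 added to the exponents, and \<open>S\<close> and \<open>T\<close>
  contribute the \<open>K\<close>.\<close>

lemma pade_approximations:
  fixes c :: "nat \<Rightarrow> int"
  defines "F \<equiv> Abs_fps c"
  assumes d: "d \<ge> 2" and b: "b \<ge> 2"
    and F: "unit_disc_summable F"
    and \<xi>: "\<And>m. \<xi> m = pser (fps_nth F) (1 / real b ^ d ^ m)"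
    and iter: "\<And>m. \<exists>S T U :: int. S \<noteq> 0 \<and> T \<noteq> 0 \<and> of_int S * \<xi> 0 = of_int U + of_int T * \<xi> m \<and>
      \<bar>real_of_int S\<bar> \<le> (real b ^ d ^ m) ^ K \<and> \<bar>real_of_int T\<bar> \<le> (real b ^ d ^ m) ^ K"
    and hank: "hankel_det c n \<noteq> 0" "hankel_det c n' \<noteq> 0" "n < n'"
  shows "\<forall>\<^sub>F m in sequentially. \<exists>q p :: int. q > 0 \<and> of_int q \<le> (real b ^ d ^ m) ^ (n + K + 1) \<and>
    1 \<le> \<bar>of_int q * \<xi> 0 - of_int p\<bar> * (real b ^ d ^ m) ^ n' \<and>
    \<bar>of_int q * \<xi> 0 - of_int p\<bar> * (real b ^ d ^ m) ^ n \<le> (real b ^ d ^ m) ^ (K + 1)"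
proof -
  obtain Q P G e where QP: "degree Q \<le> n" "degree P \<le> n" "coeff Q 0 \<noteq> 0" "2 * n \<le> e" "e < n + n'"
    "fps_nth G 0 \<noteq> 0" "fps_of_poly Q * F = fps_of_poly P + fps_X ^ e * G"
    using pade_approximant[OF hank] unfolding F_def by blast
  define x where "x = (\<lambda>m. 1 / real b ^ d ^ m)"
  have x0: "x \<longlonglongrightarrow> 0" unfolding x_def by (rule inverse_tower_tendsto_0[OF d b])
  have XG: "unit_disc_summable (fps_X ^ e * G)"
  proof -
    have "fps_X ^ e * G = fps_of_poly Q * F + fps_of_poly (- P)"
      unfolding QP(7) by (simp add: fps_of_poly_uminus)
    then show ?thesis
      by (simp add: unit_disc_summable_add unit_disc_summable_mult unit_disc_summable_poly F)
  qed
  have G: "unit_disc_summable G" using XG by (rule unit_disc_summable_X_power_cancel)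
  have Q_lim: "(\<lambda>m. int_poly_eval Q (x m)) \<longlonglongrightarrow> of_int (coeff Q 0)"
    using pser_tendsto_at_0[OF unit_disc_summable_poly x0, of Q] by (simp add: pser_fps_of_poly)
  have G_lim: "(\<lambda>m. pser (fps_nth G) (x m)) \<longlonglongrightarrow> of_int (fps_nth G 0)"
    by (rule pser_tendsto_at_0[OF G x0])
  have ev1: "\<forall>\<^sub>F m in sequentially. int_poly_eval Q (x m) \<noteq> 0"
    using QP(3) by (intro tendsto_imp_eventually_ne[OF Q_lim]) simp
  have "(\<lambda>m. \<bar>int_poly_eval Q (x m)\<bar> * x m) \<longlonglongrightarrow> \<bar>of_int (coeff Q 0)\<bar> * 0"
    by (intro tendsto_intros Q_lim x0)
  then have ev2: "\<forall>\<^sub>F m in sequentially. \<bar>int_poly_eval Q (x m)\<bar> * x m < 1"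
    by (rule order_tendstoD) simp
  have "(\<lambda>m. \<bar>pser (fps_nth G) (x m)\<bar> * x m) \<longlonglongrightarrow> \<bar>of_int (fps_nth G 0)\<bar> * 0"
    by (intro tendsto_intros G_lim x0)
  then have ev3: "\<forall>\<^sub>F m in sequentially. \<bar>pser (fps_nth G) (x m)\<bar> * x m < 1"
    by (rule order_tendstoD) simp
  have "(\<lambda>m. \<bar>pser (fps_nth G) (x m)\<bar> - x m) \<longlonglongrightarrow> \<bar>of_int (fps_nth G 0)\<bar> - 0"
    by (intro tendsto_intros G_lim x0)
  \<comment> \<open>The value of \<open>G\<close> is eventually above 1/X, and e + 1 <= n + n'
    leaves just this one factor to spare in the lower bound.\<close>
  then have ev4: "\<forall>\<^sub>F m in sequentially. \<bar>pser (fps_nth G) (x m)\<bar> - x m > 0"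
    by (rule order_tendstoD) (use QP(6) in simp)
  from ev1 ev2 ev3 ev4 show ?thesis
  proof eventually_elim
    case (elim m)
    define X where "X = real b ^ d ^ m"
    have xX: "x m = 1 / X" by (simp add: x_def X_def)
    have "real b ^ 1 \<le> X" using b d unfolding X_def by (intro power_increasing) auto
    then have "X \<ge> 2" using b by simp
    define g where "g = \<bar>pser (fps_nth G) (x m)\<bar>"
    have x1: "norm (x m) < 1" using \<open>X \<ge> 2\<close> by (simp add: xX)
    obtain S T U where ST: "S \<noteq> 0" "T \<noteq> 0" "of_int S * \<xi> 0 = of_int U + of_int T * \<xi> m"
      "\<bar>real_of_int S\<bar> \<le> X ^ K" "\<bar>real_of_int T\<bar> \<le> X ^ K" unfolding X_def using iter[of m] by blast
    obtain y where y: "of_int y = X ^ n * int_poly_eval Q (x m)"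
      using int_poly_eval_inverse_scaled[OF QP(1), of "b ^ d ^ m"] b by (auto simp: X_def x_def)
    obtain w where w: "of_int w = X ^ n * int_poly_eval P (x m)"
      using int_poly_eval_inverse_scaled[OF QP(2), of "b ^ d ^ m"] b by (auto simp: X_def x_def)
    have "int_poly_eval Q (x m) * \<xi> m = pser (fps_nth (fps_of_poly Q * F)) (x m)"
      using x1 F by (simp add: pser_fps_mult unit_disc_summable_poly pser_fps_of_poly \<xi> x_def)
    also have "\<dots> = int_poly_eval P (x m) + x m ^ e * pser (fps_nth G) (x m)"
      unfolding QP(7) using x1 XG G
      by (simp only: pser_fps_add unit_disc_summable_poly pser_fps_of_poly pser_X_power_mult)
    finally have rem: "of_int y * \<xi> m = of_int w + X ^ n * x m ^ e * pser (fps_nth G) (x m)"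
      unfolding y w by (simp only: mult.assoc distrib_left)
    define q where "q = y * S"
    define p where "p = y * U + T * w"
    have "of_int q * \<xi> 0 = of_int y * (of_int S * \<xi> 0)" by (simp add: q_def)
    also have "\<dots> = of_int (y * U) + of_int T * (of_int y * \<xi> m)"
      unfolding ST(3) by (simp add: algebra_simps)
    finally have "of_int q * \<xi> 0 - of_int p = of_int T * (X ^ n * x m ^ e * pser (fps_nth G) (x m))"
      unfolding rem by (simp add: p_def algebra_simps)
    then have diff: "\<bar>of_int q * \<xi> 0 - of_int p\<bar> = \<bar>of_int T\<bar> * (X ^ n * x m ^ e * g)"
      using \<open>X \<ge> 2\<close> by (simp add: g_def abs_mult xX)
    have "of_int y \<noteq> (0::real)" unfolding y using elim(1) \<open>X \<ge> 2\<close> by simp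
    then have "q \<noteq> 0" using ST(1) by (simp add: q_def)
    have "\<bar>int_poly_eval Q (x m)\<bar> \<le> X" using elim(2) \<open>X \<ge> 2\<close> by (simp add: xX field_simps)
    then have "\<bar>of_int y\<bar> \<le> X ^ n * X"
      unfolding y abs_mult using \<open>X \<ge> 2\<close> by (simp add: mult_left_mono)
    then have "\<bar>of_int y\<bar> * \<bar>real_of_int S\<bar> \<le> X ^ n * X * X ^ K"
      using ST(4) \<open>X \<ge> 2\<close> by (intro mult_mono) auto
    then have q_le: "\<bar>of_int q\<bar> \<le> X ^ (n + K + 1)"
      by (simp add: q_def abs_mult power_add mult_ac)
    have "g \<le> X" "1 / X \<le> g"
      using elim(3,4) \<open>X \<ge> 2\<close> by (auto simp: xX g_def field_simps)
    have lower: "1 \<le> \<bar>of_int q * \<xi> 0 - of_int p\<bar> * X ^ n'"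
    proof -
      have "1 = X ^ (n + n') * x m ^ (n + n')"
        using \<open>X \<ge> 2\<close> by (simp add: xX power_divide)
      also have "\<dots> \<le> X ^ (n + n') * (x m ^ e * g)"
      proof (rule mult_left_mono)
        have "x m ^ (n + n') \<le> x m ^ Suc e"
          using QP(5) \<open>X \<ge> 2\<close> by (intro power_decreasing) (auto simp: xX)
        also have "\<dots> = x m ^ e * (1 / X)" by (simp add: xX)
        also have "\<dots> \<le> x m ^ e * g" using \<open>1 / X \<le> g\<close> \<open>X \<ge> 2\<close> by (intro mult_left_mono) (auto simp: xX)
        finally show "x m ^ (n + n') \<le> x m ^ e * g" .
      qed (use \<open>X \<ge> 2\<close> in simp)
      also have "\<dots> = 1 * (X ^ n * x m ^ e * g) * X ^ n'" by (simp add: power_add)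
      also have "\<dots> \<le> \<bar>of_int T\<bar> * (X ^ n * x m ^ e * g) * X ^ n'"
        using ST(2) \<open>X \<ge> 2\<close> by (intro mult_right_mono) (auto simp: g_def xX)
      finally show ?thesis by (simp only: diff)
    qed
    have upper: "\<bar>of_int q * \<xi> 0 - of_int p\<bar> * X ^ n \<le> X ^ (K + 1)"
    proof -
      have "\<bar>of_int q * \<xi> 0 - of_int p\<bar> * X ^ n = \<bar>of_int T\<bar> * g * (X ^ (2 * n) * x m ^ e)"
      proof -
        have "X ^ (2 * n) = X ^ n * X ^ n" by (simp add: mult_2 power_add)
        then show ?thesis unfolding diff by (simp only: mult_ac)
      qed
      also have "\<dots> \<le> X ^ K * X * 1"
      proof (intro mult_mono)
        have "x m ^ e \<le> x m ^ (2 * n)" using QP(4) \<open>X \<ge> 2\<close> by (intro power_decreasing) (auto simp: xX)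
        then have "X ^ (2 * n) * x m ^ e \<le> X ^ (2 * n) * x m ^ (2 * n)"
          using \<open>X \<ge> 2\<close> by (intro mult_left_mono) auto
        then show "X ^ (2 * n) * x m ^ e \<le> 1" using \<open>X \<ge> 2\<close> by (simp add: xX power_divide)
      qed (use ST(5) \<open>g \<le> X\<close> \<open>X \<ge> 2\<close> in \<open>auto simp: g_def xX\<close>)
      finally show ?thesis by (simp add: mult.commute)
    qed
    show ?case
      unfolding X_def[symmetric]
    proof (cases "q > 0")
      case True
      then show "\<exists>q p. 0 < q \<and> of_int q \<le> X ^ (n + K + 1) \<and> 1 \<le> \<bar>of_int q * \<xi> 0 - of_int p\<bar> * X ^ n' \<and>
          \<bar>of_int q * \<xi> 0 - of_int p\<bar> * X ^ n \<le> X ^ (K + 1)"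
        using q_le lower upper by (intro exI[of _ q] exI[of _ p]) simp
    next
      \<comment> \<open>The estimates are unchanged when q and p both change sign.\<close>
      case False
      have "\<bar>of_int (- q) * \<xi> 0 - of_int (- p)\<bar> = \<bar>of_int q * \<xi> 0 - of_int p\<bar>" by simp
      then show "\<exists>q p. 0 < q \<and> of_int q \<le> X ^ (n + K + 1) \<and> 1 \<le> \<bar>of_int q * \<xi> 0 - of_int p\<bar> * X ^ n' \<and>
          \<bar>of_int q * \<xi> 0 - of_int p\<bar> * X ^ n \<le> X ^ (K + 1)"
        using q_le lower upper False \<open>q \<noteq> 0\<close> by (intro exI[of _ "- q"] exI[of _ "- p"]) simp
    qed
  qed
qed

text \<open>Compare p/q with an approximation p'/q' at Y = 2 q. If the fractions differ, the nonzero
  integer p q' - p' q keeps \<xi> away from p/q; if they agree, the lower bound on the linear form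
  does. Both cases give a distance of at least (2 q)^-(alpha + beta).\<close>

lemma irrationality_exponent_le:
  fixes \<xi> \<alpha> \<beta> Y0 :: real
  assumes "\<alpha> \<ge> 0" "\<beta> \<ge> 1"
    and approx: "\<And>Y. Y \<ge> Y0 \<Longrightarrow> Y \<ge> 1 \<Longrightarrow> \<exists>q p :: int. q > 0 \<and> of_int q \<le> Y powr \<alpha> \<and>
      Y powr - \<beta> \<le> \<bar>of_int q * \<xi> - of_int p\<bar> \<and> \<bar>of_int q * \<xi> - of_int p\<bar> \<le> 1 / Y"
  shows "irrationality_exponent \<xi> \<le> ereal (\<alpha> + \<beta>)"
  unfolding irrationality_exponent_def
proof (rule Sup_least, clarify)
  fix \<mu> assume inf: "infinite {pq :: int \<times> int. let p = fst pq; q = snd pq in q > 0 \<and>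
    \<bar>\<xi> - real_of_int p / real_of_int q\<bar> < real_of_int q powr (- \<mu>)}" (is "infinite ?A")
  show "ereal \<mu> \<le> ereal (\<alpha> + \<beta>)"
  proof (rule ccontr)
    assume "\<not> ereal \<mu> \<le> ereal (\<alpha> + \<beta>)"
    then have \<mu>: "\<mu> > \<alpha> + \<beta>" by simp
    have lower: "(2 * of_int q) powr - (\<alpha> + \<beta>) \<le> \<bar>\<xi> - of_int p / of_int q\<bar>"
      if q: "q > 0" "2 * of_int q \<ge> Y0" for p q :: int
    proof -
      \<comment> \<open>The factor 2 makes q times the linear form at most 1/2, so at least half of
        the integer p q' - p' q must come from the distance of \<xi> to p/q.\<close>
      define Y where "Y = 2 * real_of_int q"
      have q1: "real_of_int q \<ge> 1" using q(1) by simp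
      then have "Y \<ge> 1" "Y > 0" by (simp_all add: Y_def)
      obtain q' p' :: int where a: "q' > 0" "of_int q' \<le> Y powr \<alpha>" "Y powr - \<beta> \<le> \<bar>of_int q' * \<xi> - of_int p'\<bar>"
          "\<bar>of_int q' * \<xi> - of_int p'\<bar> \<le> 1 / Y"
        using approx[of Y] \<open>Y \<ge> 1\<close> q(2) by (auto simp: Y_def)
      define \<delta> where "\<delta> = \<bar>\<xi> - of_int p / of_int q\<bar>"
      have q'0: "real_of_int q' > 0" using a(1) by simp
      have Ya: "Y powr - \<alpha> * real_of_int q' \<le> 1"
      proof -
        have "Y powr - \<alpha> * real_of_int q' \<le> Y powr - \<alpha> * Y powr \<alpha>" using a(2) by (intro mult_left_mono) auto
        then show ?thesis using \<open>Y > 0\<close> by (simp flip: powr_add)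
      qed
      have "Y powr - (\<alpha> + \<beta>) * real_of_int q' \<le> \<delta> * real_of_int q'"
      proof (cases "p * q' = p' * q")
        case True
        then have "of_int p / of_int q = (of_int p' / of_int q' :: real)"
          using q1 q'0 by (simp add: field_simps flip: of_int_mult)
        then have "\<delta> * real_of_int q' = \<bar>of_int q' * \<xi> - of_int p'\<bar>"
        proof -
          have "(\<xi> - of_int p / of_int q) * of_int q' = of_int q' * \<xi> - of_int p'"
            unfolding \<open>of_int p / of_int q = _\<close> using q'0 by (simp add: field_simps)
          then show ?thesis using q'0 unfolding \<delta>_def by (metis abs_mult abs_of_pos)
        qed
        moreover have "Y powr - (\<alpha> + \<beta>) * real_of_int q' = Y powr - \<beta> * (Y powr - \<alpha> * real_of_int q')"
          by (simp add: powr_add[symmetric] algebra_simps flip: mult.assoc)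
        moreover have "\<dots> \<le> Y powr - \<beta> * 1" using Ya by (intro mult_left_mono) auto
        ultimately show ?thesis using a(3) by linarith
      next
        case False
        have "1 \<le> \<bar>real_of_int (p * q' - p' * q)\<bar>" using False by linarith
        also have "real_of_int (p * q' - p' * q) =
            of_int q * (of_int q' * \<xi> - of_int p') - of_int q' * of_int q * (\<xi> - of_int p / of_int q)"
          using q1 by (simp add: field_simps)
        also have "\<bar>\<dots>\<bar> \<le> of_int q * \<bar>of_int q' * \<xi> - of_int p'\<bar> + of_int q' * of_int q * \<delta>"
          using q1 q'0 by (intro order_trans[OF abs_triangle_ineq4]) (simp add: abs_mult \<delta>_def)
        also have "of_int q * \<bar>of_int q' * \<xi> - of_int p'\<bar> \<le> of_int q * (1 / Y)"
          using a(4) q1 by (intro mult_left_mono) auto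
        also have "of_int q * (1 / Y) = 1 / 2" using q1 by (simp add: Y_def)
        finally have "1 / 2 \<le> of_int q' * of_int q * \<delta>" by simp
        then have "1 / Y \<le> \<delta> * real_of_int q'" using q1 by (simp add: Y_def field_simps)
        moreover have "Y powr - (\<alpha> + \<beta>) * real_of_int q' = Y powr - \<beta> * (Y powr - \<alpha> * real_of_int q')"
          by (simp add: powr_add[symmetric] algebra_simps flip: mult.assoc)
        moreover have "\<dots> \<le> Y powr - \<beta> * 1" using Ya by (intro mult_left_mono) auto
        moreover have "Y powr - \<beta> \<le> Y powr - 1" using \<open>\<beta> \<ge> 1\<close> \<open>Y \<ge> 1\<close> by (intro powr_mono) auto
        moreover have "Y powr - 1 = 1 / Y" using \<open>Y > 0\<close> by (simp add: powr_minus_divide)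
        ultimately show ?thesis by linarith
      qed
      then show ?thesis using q'0 by (simp add: Y_def \<delta>_def)
    qed
    define \<eta> where "\<eta> = \<mu> - (\<alpha> + \<beta>)"
    have "\<eta> > 0" using \<mu> by (simp add: \<eta>_def)
    \<comment> \<open>Beyond \<open>q0\<close> the lower bound applies and q^eta outweighs the
      constant 2^(alpha + beta).\<close>
    define q0 where "q0 = max Y0 (2 powr ((\<alpha> + \<beta>) / \<eta>))"
    have q_bound: "of_int q \<le> q0" if "(p, q) \<in> ?A" for p q :: int
    proof (rule ccontr)
      assume "\<not> of_int q \<le> q0"
      then have q: "of_int q > Y0" "of_int q > 2 powr ((\<alpha> + \<beta>) / \<eta>)" by (auto simp: q0_def)
      have "q > 0" using that by (simp add: Let_def)
      then have q1: "real_of_int q \<ge> 1" by simp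
      have "(2 * of_int q) powr - (\<alpha> + \<beta>) < of_int q powr - \<mu>"
        using lower[OF \<open>q > 0\<close>, of p] q(1) q1 that by (simp add: Let_def)
      then have "(2 * of_int q) powr - (\<alpha> + \<beta>) * of_int q powr \<mu> < of_int q powr - \<mu> * of_int q powr \<mu>"
        using q1 by (intro mult_strict_right_mono) auto
      also have "\<dots> = 1" using q1 by (simp flip: powr_add)
      also have "(2 * of_int q) powr - (\<alpha> + \<beta>) * of_int q powr \<mu> = 2 powr - (\<alpha> + \<beta>) * of_int q powr \<eta>"
        using q1 by (simp add: powr_mult \<eta>_def powr_diff powr_minus_divide powr_add divide_simps)
      finally have "2 powr - (\<alpha> + \<beta>) * of_int q powr \<eta> < 1" .
      moreover have "2 powr (\<alpha> + \<beta>) < of_int q powr \<eta>"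
      proof -
        have "(2 powr ((\<alpha> + \<beta>) / \<eta>)) powr \<eta> < of_int q powr \<eta>"
          using q(2) \<open>\<eta> > 0\<close> by (intro powr_less_mono2) auto
        then show ?thesis using \<open>\<eta> > 0\<close> by (simp add: powr_powr)
      qed
      then have "2 powr - (\<alpha> + \<beta>) * 2 powr (\<alpha> + \<beta>) < 2 powr - (\<alpha> + \<beta>) * of_int q powr \<eta>"
        by (intro mult_strict_left_mono) auto
      then have "1 < 2 powr - (\<alpha> + \<beta>) * of_int q powr \<eta>" by (simp flip: powr_add)
      ultimately show False by simp
    qed
    \<comment> \<open>The set consists of pairs, reduced or not, so its finiteness takes a bound on
      p besides the one on q.\<close>
    define p0 where "p0 = q0 * (\<bar>\<xi>\<bar> + 1)"
    have "?A \<subseteq> {- \<lceil>p0\<rceil>..\<lceil>p0\<rceil>} \<times> {0..\<lceil>q0\<rceil>}"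
    proof (rule subsetI)
      fix pq assume "pq \<in> ?A"
      then obtain p q where pq: "(p, q) \<in> ?A" "pq = (p, q)" by (cases pq) blast
      from pq(1) have "q > 0" by (simp add: Let_def)
      then have q1: "real_of_int q \<ge> 1" by simp
      have q0: "of_int q \<le> q0" by (rule q_bound[OF pq(1)])
      have "of_int q powr - \<mu> \<le> of_int q powr 0" using q1 \<mu> assms(1,2) by (intro powr_mono) auto
      then have "\<bar>\<xi> - of_int p / of_int q\<bar> \<le> 1" using pq(1) q1 by (simp add: Let_def)
      then have "\<bar>of_int p / of_int q\<bar> \<le> \<bar>\<xi>\<bar> + 1" by linarith
      then have "\<bar>of_int p\<bar> \<le> of_int q * (\<bar>\<xi>\<bar> + 1)" using q1 by (simp add: abs_divide field_simps)
      also have "\<dots> \<le> p0" unfolding p0_def using q0 by (intro mult_right_mono) auto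
      finally have "\<bar>of_int p\<bar> \<le> p0" .
      then show "pq \<in> {- \<lceil>p0\<rceil>..\<lceil>p0\<rceil>} \<times> {0..\<lceil>q0\<rceil>}"
        unfolding pq(2) using q0 \<open>q > 0\<close> by simp linarith
    qed
    then have "finite ?A" by (rule finite_subset) simp
    with inf show False by simp
  qed
qed

text \<open>Dirichlet's theorem supplies infinitely many coprime pairs, which form a subset of the
  pairs counted by the exponent.\<close>

lemma irrationality_exponent_ge_2:
  fixes \<xi> :: real
  assumes "\<xi> \<notin> \<rat>"
  shows "2 \<le> irrationality_exponent \<xi>"
proof -
  have "infinite {(p, q). q > 0 \<and> coprime p q \<and> \<bar>\<xi> - of_int p / of_int q\<bar> < 1 / (of_int q)\<^sup>2}"
    using assms rational_iff_finite_approx_set[of \<xi>] by (simp add: approx_set_def)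
  moreover have "{(p, q). q > 0 \<and> coprime p q \<and> \<bar>\<xi> - of_int p / of_int q\<bar> < 1 / (of_int q)\<^sup>2}
     \<subseteq> {pq :: int \<times> int. let p = fst pq; q = snd pq in q > 0 \<and>
                          \<bar>\<xi> - real_of_int p / real_of_int q\<bar> < real_of_int q powr (- 2)}"
    by (auto simp: Let_def powr_minus_divide powr_numeral)
  ultimately have "2 \<in> {\<mu>. infinite {pq :: int \<times> int. let p = fst pq; q = snd pq in q > 0 \<and>
                          \<bar>\<xi> - real_of_int p / real_of_int q\<bar> < real_of_int q powr (- \<mu>)}}"
    using infinite_super by blast
  then have "ereal 2 \<le> irrationality_exponent \<xi>"
    unfolding irrationality_exponent_def by (intro Sup_upper imageI)
  then show ?thesis by simp
qed

section \<open>Scales of approximations\<close>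

text \<open>The start \<open>k0\<close> will be the threshold from which approximations are known to
  exist.\<close>

lemma geometric_scale:
  fixes a Z r :: real
  assumes "a > 0" "r > 1" "Z \<ge> a * r ^ k0"
  shows "\<exists>k\<ge>k0. a * r ^ k \<le> Z \<and> Z < a * r ^ Suc k"
proof -
  define k where "k = (LEAST k. Z < a * r ^ Suc k)"
  obtain j where "Z / a < r ^ j" using real_arch_pow[OF assms(2)] by blast
  also have "r ^ j \<le> r ^ Suc j" using assms(2) by (intro power_increasing) auto
  finally have ex: "Z < a * r ^ Suc j" using assms(1) by (simp add: divide_less_eq mult.commute)
  have k: "Z < a * r ^ Suc k" unfolding k_def by (rule LeastI[of _ j]) (rule ex)
  then have "a * r ^ k0 < a * r ^ Suc k" using assms(3) by linarith
  then have "k0 < Suc k" using assms(1,2) by (simp only: mult_less_cancel_left_pos power_strict_increasing_iff)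
  moreover have "a * r ^ k \<le> Z"
  proof (cases "k = k0")
    case False
    then obtain l where l: "k = Suc l" using \<open>k0 < Suc k\<close> by (cases k) auto
    then have "\<not> Z < a * r ^ Suc l" unfolding k_def by (intro not_less_Least) simp
    then show ?thesis by (simp add: l)
  qed (use assms(3) in simp)
  ultimately show ?thesis using k by (intro exI[of _ k]) simp
qed

text \<open>The thresholds \<open>m0 i\<close> may grow with i in any way. If \<open>r\<close> is at
  most d, the indices from \<open>I\<close> to some \<open>J\<close> span a factor of at least d,
  and powers of d repeat them; if \<open>r\<close> exceeds d, the index \<open>I\<close> alone
  already has quotient d.\<close>

lemma scales_cover:
  fixes n m0 :: "nat \<Rightarrow> nat" and r :: real
  assumes d: "d \<ge> 2" and mono: "strict_mono n" and pos: "\<And>i. n i > 0"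
    and ratio: "\<And>i. i \<ge> I \<Longrightarrow> real (n (Suc i)) \<le> r * real (n i)"
  shows "\<exists>Z0. \<forall>Z\<ge>Z0. \<exists>i\<ge>I. \<exists>m\<ge>m0 i. Z \<le> real (n i) * real d ^ m \<and>
    real (n i) * real d ^ m \<le> min r (real d) * Z"
proof (cases "r \<le> real d")
  case True
  \<comment> \<open>Strict monotonicity gives \<open>J \<le> n J\<close>, so this choice ensures
    \<open>d * n I \<le> n J\<close>.\<close>
  define J where "J = I + d * n I"
  have "J \<le> n J" by (rule strict_mono_imp_increasing[OF mono])
  then have J: "d * n I \<le> n J" "I \<le> J" by (simp_all add: J_def)
  define M where "M = (\<Sum>i\<le>J. m0 i)"
  have M: "m0 i \<le> M" if "i \<le> J" for i unfolding M_def using that by (intro member_le_sum) auto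
  have "\<exists>i\<ge>I. \<exists>m\<ge>m0 i. Z \<le> real (n i) * real d ^ m \<and> real (n i) * real d ^ m \<le> min r (real d) * Z"
    if Z: "Z \<ge> real (n I) * real d ^ M" for Z
  proof -
    obtain k where k: "k \<ge> M" "real (n I) * real d ^ k \<le> Z" "Z < real (n I) * real d ^ Suc k"
      using geometric_scale[of "real (n I)" "real d" M Z] Z pos d by auto
    \<comment> \<open>With \<open>k\<close> fixed, the first index whose scale exceeds
      \<open>Z\<close> is wanted: its predecessor has scale at most \<open>Z\<close>, and their
      quotient is at most \<open>r\<close>.\<close>
    define P where "P = (\<lambda>i. i \<ge> I \<and> Z < real (n i) * real d ^ k)"
    have "P J"
    proof -
      have "real (n I) * real d ^ Suc k = real (d * n I) * real d ^ k" by simp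
      also have "\<dots> \<le> real (n J) * real d ^ k" using J(1) by (intro mult_right_mono) (auto simp flip: of_nat_mult)
      finally show ?thesis using k(3) J(2) by (simp add: P_def)
    qed
    define i where "i = (LEAST i. P i)"
    have "P i" "i \<le> J" unfolding i_def using \<open>P J\<close> by (rule LeastI, rule Least_le)
    have "i \<noteq> I" using \<open>P i\<close> k(2) by (auto simp: P_def)
    then obtain l where l: "i = Suc l" "l \<ge> I" using \<open>P i\<close> by (cases i) (auto simp: P_def)
    have "\<not> P l" using l(1) unfolding i_def by (intro not_less_Least) simp
    then have "real (n l) * real d ^ k \<le> Z" using l(2) by (simp add: P_def)
    moreover have "r \<ge> 0" using ratio[of I] pos[of I] by (metis of_nat_0_le_iff of_nat_0_less_iff order_refl order_trans zero_le_mult_iff not_less)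
    ultimately have "r * (real (n l) * real d ^ k) \<le> r * Z" by (intro mult_left_mono)
    moreover have "real (n i) * real d ^ k \<le> r * real (n l) * real d ^ k"
      unfolding l(1) using ratio[OF l(2)] by (intro mult_right_mono) auto
    ultimately have "real (n i) * real d ^ k \<le> min r (real d) * Z" using True by (simp add: min_def mult.assoc)
    moreover have "Z \<le> real (n i) * real d ^ k" "i \<ge> I" using \<open>P i\<close> by (auto simp: P_def)
    moreover have "k \<ge> m0 i" using M[OF \<open>i \<le> J\<close>] k(1) by simp
    ultimately show ?thesis by blast
  qed
  then show ?thesis by blast
next
  case False
  have "\<exists>i\<ge>I. \<exists>m\<ge>m0 i. Z \<le> real (n i) * real d ^ m \<and> real (n i) * real d ^ m \<le> min r (real d) * Z"
    if Z: "Z \<ge> real (n I) * real d ^ m0 I" for Z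
  proof -
    obtain k where k: "k \<ge> m0 I" "real (n I) * real d ^ k \<le> Z" "Z < real (n I) * real d ^ Suc k"
      using geometric_scale[of "real (n I)" "real d" "m0 I" Z] Z pos d by auto
    have "real (n I) * real d ^ Suc k = real d * (real (n I) * real d ^ k)" by simp
    also have "\<dots> \<le> real d * Z" using k(2) by (intro mult_left_mono) auto
    finally have "real (n I) * real d ^ Suc k \<le> min r (real d) * Z" using False by (simp add: min_def)
    then show ?thesis using k(1,3) by (intro exI[of _ I] conjI order_refl exI[of _ "Suc k"]) auto
  qed
  then show ?thesis by blast
qed

text \<open>At a scale T = n_i d^m the data say, up to epsilon, that q <= b^T and b^(-rho T) <= |q
  \<xi> - p| <= b^(-T). For Y close to b^Z with Z <= T <= theta Z, these become the exponents theta
  and rho theta.\<close>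

lemma approximations_imp_exponent_le:
  fixes n :: "nat \<Rightarrow> nat" and \<rho> \<xi> :: real
  assumes d: "d \<ge> 2" and b: "b \<ge> 2" and mono: "strict_mono n" and pos: "\<And>i. n i > 0"
    and lims: "limsup (\<lambda>i. ereal (real (n (Suc i)) / real (n i))) = ereal \<rho>"
    and approx: "\<And>i. \<forall>\<^sub>F m in sequentially. \<exists>q p :: int. q > 0 \<and> of_int q \<le> (real b ^ d ^ m) ^ (n i + K + 1) \<and>
      1 \<le> \<bar>of_int q * \<xi> - of_int p\<bar> * (real b ^ d ^ m) ^ n (Suc i) \<and>
      \<bar>of_int q * \<xi> - of_int p\<bar> * (real b ^ d ^ m) ^ n i \<le> (real b ^ d ^ m) ^ (K + 1)"
  shows "\<rho> \<ge> 1" "irrationality_exponent \<xi> \<le> ereal ((1 + \<rho>) * min \<rho> (real d))"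
proof -
  have "1 \<le> real (n (Suc i)) / real (n i)" for i
    using pos[of i] strict_monoD[OF mono, of i "Suc i"] by simp
  then have "ereal 1 \<le> limsup (\<lambda>i. ereal (real (n (Suc i)) / real (n i)))"
    by (intro le_Limsup always_eventually) auto
  then show \<rho>: "\<rho> \<ge> 1" by (simp add: lims)
  have step: "irrationality_exponent \<xi> \<le> ereal ((1 + \<rho> + 2 * \<epsilon>) * min (\<rho> + \<epsilon>) (real d) / (1 - \<epsilon>))"
    if \<epsilon>: "0 < \<epsilon>" "\<epsilon> < 1 / 2" for \<epsilon>
  proof -
    define \<theta> where "\<theta> = min (\<rho> + \<epsilon>) (real d)"
    have "\<theta> \<ge> 1" using \<rho> \<epsilon> d by (simp add: \<theta>_def)
    have "\<forall>\<^sub>F i in sequentially. ereal (real (n (Suc i)) / real (n i)) < ereal (\<rho> + \<epsilon>)"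
      by (rule Limsup_lessD) (use lims \<epsilon> in simp)
    then obtain I1 where I1: "\<And>i. i \<ge> I1 \<Longrightarrow> real (n (Suc i)) / real (n i) < \<rho> + \<epsilon>"
      by (auto simp: eventually_sequentially)
    \<comment> \<open>From \<open>I2\<close> on, the overhead K + 1 is at most epsilon times
      n_i.\<close>
    obtain I2 where I2: "(real K + 1) / \<epsilon> < real I2" using reals_Archimedean2 by blast
    define I where "I = max I1 I2"
    have ratio: "real (n (Suc i)) \<le> (\<rho> + \<epsilon>) * real (n i)" if "i \<ge> I" for i
      using I1[of i] that pos[of i] by (simp add: I_def divide_less_eq)
    have large: "real K + 1 \<le> \<epsilon> * real (n i)" if "i \<ge> I" for i
    proof -
      have "I2 \<le> n i" using that strict_mono_imp_increasing[OF mono, of i] by (simp add: I_def)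
      then have "(real K + 1) / \<epsilon> \<le> real (n i)" using I2 by linarith
      then show ?thesis using \<epsilon> by (simp add: divide_le_eq mult.commute)
    qed
    obtain m0 where m0: "\<And>i m. m \<ge> m0 i \<Longrightarrow> \<exists>q p :: int. q > 0 \<and> of_int q \<le> (real b ^ d ^ m) ^ (n i + K + 1) \<and>
      1 \<le> \<bar>of_int q * \<xi> - of_int p\<bar> * (real b ^ d ^ m) ^ n (Suc i) \<and>
      \<bar>of_int q * \<xi> - of_int p\<bar> * (real b ^ d ^ m) ^ n i \<le> (real b ^ d ^ m) ^ (K + 1)"
      using approx unfolding eventually_sequentially by metis
    obtain Z0 where Z0: "\<And>Z. Z \<ge> Z0 \<Longrightarrow> \<exists>i\<ge>I. \<exists>m\<ge>m0 i. Z \<le> real (n i) * real d ^ m \<and>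
        real (n i) * real d ^ m \<le> \<theta> * Z"
      using scales_cover[OF d mono pos ratio, where ?m0.0 = m0] unfolding \<theta>_def by blast
    \<comment> \<open>The worst case T = theta Z for the denominator and the lower bound, measured
      in powers of Y = b^((1 - epsilon) Z); this normalisation causes the division.\<close>
    define \<alpha> where "\<alpha> = (1 + \<epsilon>) * \<theta> / (1 - \<epsilon>)"
    define \<beta> where "\<beta> = (\<rho> + \<epsilon>) * \<theta> / (1 - \<epsilon>)"
    define \<gamma> where "\<gamma> = real b powr ((1 - \<epsilon>) * Z0)"
    have b0: "real b > 0" "real b > 1" using b by auto
    have "irrationality_exponent \<xi> \<le> ereal (\<alpha> + \<beta>)"
    proof (rule irrationality_exponent_le[where ?Y0.0 = \<gamma>])
      show "\<alpha> \<ge> 0" using \<epsilon> \<open>\<theta> \<ge> 1\<close> by (simp add: \<alpha>_def)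
      have "1 * 1 \<le> (\<rho> + \<epsilon>) * \<theta>" using \<rho> \<epsilon> \<open>\<theta> \<ge> 1\<close> by (intro mult_mono) auto
      then show "\<beta> \<ge> 1" using \<epsilon> by (simp add: \<beta>_def le_divide_eq)
      fix Y :: real assume Y: "Y \<ge> \<gamma>" "Y \<ge> 1"
      \<comment> \<open>Solves Y = b^((1 - epsilon) Z); the lost epsilon pays for the overhead in |q
        \<xi> - p| <= b^(-(1 - epsilon) T).\<close>
      define Z where "Z = log (real b) Y / (1 - \<epsilon>)"
      have YZ: "Y = real b powr ((1 - \<epsilon>) * Z)" using Y(2) b0 \<epsilon> by (simp add: Z_def)
      have "(1 - \<epsilon>) * Z0 \<le> (1 - \<epsilon>) * Z" using Y(1) b0 unfolding YZ \<gamma>_def by simp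
      then have "Z \<ge> Z0" using \<epsilon> by simp
      then obtain i m where im: "i \<ge> I" "m \<ge> m0 i" "Z \<le> real (n i) * real d ^ m" "real (n i) * real d ^ m \<le> \<theta> * Z"
        using Z0 by blast
      obtain q p :: int where qp: "q > 0" "of_int q \<le> (real b ^ d ^ m) ^ (n i + K + 1)"
        "1 \<le> \<bar>of_int q * \<xi> - of_int p\<bar> * (real b ^ d ^ m) ^ n (Suc i)"
        "\<bar>of_int q * \<xi> - of_int p\<bar> * (real b ^ d ^ m) ^ n i \<le> (real b ^ d ^ m) ^ (K + 1)"
        using m0[OF im(2)] by blast
      have pw: "(real b ^ d ^ m) ^ k = real b powr (real k * real d ^ m)" for k
        using b0 by (simp add: powr_realpow[symmetric] powr_powr mult.commute)
      define T where "T = real (n i) * real d ^ m"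
      have T: "Z \<le> T" "T \<le> \<theta> * Z" using im by (simp_all add: T_def)
      have small: "(real K + 1) * real d ^ m \<le> \<epsilon> * T"
        unfolding T_def mult.assoc[symmetric] using large[OF im(1)] by (intro mult_right_mono) auto
      let ?D = "\<bar>of_int q * \<xi> - of_int p\<bar>"
      have "real (n i + K + 1) * real d ^ m = T + (real K + 1) * real d ^ m"
        by (simp add: T_def algebra_simps)
      also have "\<dots> \<le> (1 + \<epsilon>) * T" using small by (simp add: algebra_simps)
      also have "\<dots> \<le> (1 + \<epsilon>) * (\<theta> * Z)" using T \<epsilon> by (intro mult_left_mono) auto
      also have "\<dots> = (1 - \<epsilon>) * Z * \<alpha>" using \<epsilon> by (simp add: \<alpha>_def)
      finally have "of_int q \<le> real b powr ((1 - \<epsilon>) * Z * \<alpha>)"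
        using qp(2) b0 unfolding pw by (meson order_trans powr_mono less_imp_le)
      then have "of_int q \<le> Y powr \<alpha>" unfolding YZ by (simp add: powr_powr)
      moreover have "Y powr - \<beta> \<le> ?D"
      proof -
        have "real (n (Suc i)) * real d ^ m \<le> (\<rho> + \<epsilon>) * T"
          unfolding T_def mult.assoc[symmetric] using ratio[OF im(1)] by (intro mult_right_mono) auto
        also have "\<dots> \<le> (\<rho> + \<epsilon>) * (\<theta> * Z)" using T \<rho> \<epsilon> by (intro mult_left_mono) auto
        also have "\<dots> = (1 - \<epsilon>) * Z * \<beta>" using \<epsilon> by (simp add: \<beta>_def)
        finally have "real b powr (real (n (Suc i)) * real d ^ m) \<le> Y powr \<beta>"
          unfolding YZ powr_powr using b0 by (intro powr_mono) auto
        then have "?D * real b powr (real (n (Suc i)) * real d ^ m) \<le> ?D * Y powr \<beta>"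
          by (rule mult_left_mono) simp
        then have "1 \<le> ?D * Y powr \<beta>" using qp(3) unfolding pw by linarith
        then have "Y powr - \<beta> * 1 \<le> Y powr - \<beta> * (?D * Y powr \<beta>)" by (rule mult_left_mono) simp
        also have "\<dots> = ?D * (Y powr - \<beta> * Y powr \<beta>)" by (simp only: mult_ac)
        also have "\<dots> = ?D" using Y(2) by (simp flip: powr_add)
        finally show ?thesis by simp
      qed
      moreover have "?D \<le> 1 / Y"
      proof -
        have "?D * real b powr T \<le> real b powr ((real K + 1) * real d ^ m)"
          using qp(4) unfolding pw T_def by (simp add: add.commute)
        also have "\<dots> \<le> real b powr (\<epsilon> * T)" using small b0 by (intro powr_mono) auto
        finally have "?D * real b powr T * real b powr (- T) \<le> real b powr (\<epsilon> * T) * real b powr (- T)"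
          by (rule mult_right_mono) simp
        then have "?D * (real b powr T * real b powr (- T)) \<le> real b powr (\<epsilon> * T + - T)"
          by (simp only: mult.assoc powr_add)
        moreover have "real b powr T * real b powr (- T) = 1" using b0 by (simp flip: powr_add)
        moreover have "\<epsilon> * T + - T = - ((1 - \<epsilon>) * T)" by (simp add: algebra_simps)
        ultimately have "?D \<le> real b powr (- ((1 - \<epsilon>) * T))" by (simp only: mult_1_right)
        also have "\<dots> \<le> real b powr (- ((1 - \<epsilon>) * Z))"
          using T(1) \<epsilon> b0 by (intro powr_mono) auto
        also have "\<dots> = 1 / Y" unfolding YZ by (rule powr_minus_divide)
        finally show ?thesis .
      qed
      ultimately show "\<exists>q p :: int. q > 0 \<and> of_int q \<le> Y powr \<alpha> \<and>
          Y powr - \<beta> \<le> \<bar>of_int q * \<xi> - of_int p\<bar> \<and> \<bar>of_int q * \<xi> - of_int p\<bar> \<le> 1 / Y"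
        using qp(1) by blast
    qed
    also have "\<alpha> + \<beta> = (1 + \<rho> + 2 * \<epsilon>) * \<theta> / (1 - \<epsilon>)"
      by (simp add: \<alpha>_def \<beta>_def algebra_simps flip: add_divide_distrib)
    finally show ?thesis by (simp add: \<theta>_def)
  qed
  \<comment> \<open>The bound is continuous in epsilon and no longer contains \<open>K\<close> or
    the starting index, so epsilon may tend to 0.\<close>
  have "((\<lambda>\<epsilon>. (1 + \<rho> + 2 * \<epsilon>) * min (\<rho> + \<epsilon>) (real d) / (1 - \<epsilon>)) \<longlongrightarrow>
      (1 + \<rho> + 2 * 0) * min (\<rho> + 0) (real d) / (1 - 0)) (at_right (0::real))"
    by (intro tendsto_intros) auto
  then have "((\<lambda>\<epsilon>. ereal ((1 + \<rho> + 2 * \<epsilon>) * min (\<rho> + \<epsilon>) (real d) / (1 - \<epsilon>))) \<longlongrightarrow>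
      ereal ((1 + \<rho>) * min \<rho> (real d))) (at_right (0::real))"
    by simp
  moreover have "\<forall>\<^sub>F \<epsilon> in at_right (0::real). irrationality_exponent \<xi> \<le>
      ereal ((1 + \<rho> + 2 * \<epsilon>) * min (\<rho> + \<epsilon>) (real d) / (1 - \<epsilon>))"
    using eventually_at_right_real[of 0 "1 / 2"] by (rule eventually_mono) (auto intro: step)
  ultimately show "irrationality_exponent \<xi> \<le> ereal ((1 + \<rho>) * min \<rho> (real d))"
    by (rule tendsto_lowerbound) simp
qed

lemma not_algebraic_imp_irrational:
  fixes x :: real
  assumes "\<not> algebraic x"
  shows "x \<notin> \<rat>"
proof
  assume "x \<in> \<rat>"
  then have "\<forall>i. coeff [:- x, 1:] i \<in> \<rat>" by (auto simp: coeff_pCons split: nat.split)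
  moreover have "poly [:- x, 1:] x = 0" by simp
  moreover have "[:- x, 1:] \<noteq> 0" by simp
  ultimately have "algebraic x" unfolding algebraic_altdef by blast
  with assms show False by simp
qed

lemma int_poly_eval_of_real:
  "int_poly_eval P (complex_of_real x) = complex_of_real (int_poly_eval P x)"
  by (simp add: int_poly_eval_altdef[OF order_refl])

theorem theorem4p1:
  fixes d b :: nat and c :: "nat \<Rightarrow> int" and A B C D :: "int poly"
    and n :: "nat \<Rightarrow> nat" and \<rho> :: real
  assumes d2: "d \<ge> 2"
    and conv: "\<And>z::complex. norm z < 1 \<Longrightarrow> summable (\<lambda>j. of_int (c j) * z ^ j)"
    and B0: "B \<noteq> 0" and D0: "D \<noteq> 0"
    and feq: "\<And>z::complex. norm z < 1 \<Longrightarrow>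
               poly (map_poly of_int B) z \<noteq> 0 \<Longrightarrow> poly (map_poly of_int D) z \<noteq> 0 \<Longrightarrow>
               pser c z = poly (map_poly of_int A) z / poly (map_poly of_int B) z
                 + poly (map_poly of_int C) z / poly (map_poly of_int D) z * pser c (z ^ d)"
    and b2: "b \<ge> 2"
    and nonvan: "\<And>m::nat. poly (map_poly of_int B) (1 / real b ^ (d ^ m))
                       * poly (map_poly of_int C) (1 / real b ^ (d ^ m))
                       * poly (map_poly of_int D) (1 / real b ^ (d ^ m)) \<noteq> (0::real)"
    and n_mono: "strict_mono n"
    and n_pos: "\<And>i. n i > 0"
    and hank: "\<And>i. hankel_det c (n i) \<noteq> 0"
    and lims: "limsup (\<lambda>i. ereal (real (n (Suc i)) / real (n i))) = ereal \<rho>"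
  shows "\<not> algebraic (pser c (1 / real b) :: real)
         \<and> irrationality_exponent (pser c (1 / real b))
              \<le> ereal ((1 + \<rho>) * min (\<rho> ^ 2) (real d))
         \<and> (\<rho> = 1 \<longrightarrow> irrationality_exponent (pser c (1 / real b)) = 2)"
proof -
  have cF: "fps_nth (Abs_fps c) = c" by (rule ext) simp
  have F: "unit_disc_summable (Abs_fps c)" by (rule unit_disc_summable_Abs_fps[OF conv])
  define \<xi> where "\<xi> = (\<lambda>m. pser c (1 / real b ^ d ^ m))"
  have \<xi>F: "\<xi> m = pser (fps_nth (Abs_fps c)) (1 / real b ^ d ^ m)" for m by (simp only: \<xi>_def cF)
  have \<xi>0: "\<xi> 0 = pser c (1 / real b)" by (simp add: \<xi>_def)
  \<comment> \<open>The equation is assumed on the complex disc; at these real points it descends to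
    the reals because \<open>of_real\<close> is injective and commutes with the series.\<close>
  have eq: "\<xi> m = int_poly_eval A (1 / real b ^ d ^ m) / int_poly_eval B (1 / real b ^ d ^ m)
        + int_poly_eval C (1 / real b ^ d ^ m) / int_poly_eval D (1 / real b ^ d ^ m) * \<xi> (Suc m)" for m
  proof -
    define x where "x = 1 / real b ^ d ^ m"
    have "1 < real b ^ d ^ m" using b2 d2 by (intro one_less_power) auto
    then have x1: "\<bar>x\<bar> < 1" using b2 by (simp add: x_def divide_less_eq)
    have "\<bar>x ^ d\<bar> < 1" using x1 d2 by (simp add: power_abs power_less_one_iff)
    have xd: "x ^ d = 1 / real b ^ d ^ Suc m" by (simp add: x_def power_divide mult.commute flip: power_mult)
    have nz: "int_poly_eval B x \<noteq> 0" "int_poly_eval D x \<noteq> 0" using nonvan[of m] by (auto simp: x_def)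
    have "complex_of_real (pser c x) = pser c (complex_of_real x)"
      using pser_of_real[OF F x1] by (simp only: cF)
    also have "\<dots> = int_poly_eval A (complex_of_real x) / int_poly_eval B (complex_of_real x)
        + int_poly_eval C (complex_of_real x) / int_poly_eval D (complex_of_real x) * pser c (complex_of_real x ^ d)"
      using x1 nz by (intro feq) (simp_all add: int_poly_eval_of_real)
    also have "pser c (complex_of_real x ^ d) = complex_of_real (pser c (x ^ d))"
      using pser_of_real[OF F \<open>\<bar>x ^ d\<bar> < 1\<close>] by (simp only: cF of_real_power)
    finally have "complex_of_real (pser c x) = complex_of_real
        (int_poly_eval A x / int_poly_eval B x + int_poly_eval C x / int_poly_eval D x * pser c (x ^ d))"
      by (simp add: int_poly_eval_of_real)
    then have "pser c x = int_poly_eval A x / int_poly_eval B x + int_poly_eval C x / int_poly_eval D x * pser c (x ^ d)"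
      by (simp only: of_real_eq_iff)
    then show ?thesis unfolding \<xi>_def xd[symmetric] by (simp only: x_def)
  qed
  obtain K where K: "\<And>m. \<exists>s t u :: int. s \<noteq> 0 \<and> t \<noteq> 0 \<and> of_int s * \<xi> m = of_int u + of_int t * \<xi> (Suc m) \<and>
      \<bar>real_of_int s\<bar> \<le> (real b ^ d ^ m) ^ K \<and> \<bar>real_of_int t\<bar> \<le> (real b ^ d ^ m) ^ K"
    using functional_equation_step[of d b \<xi> A B C D, OF d2 b2 eq nonvan] by blast
  note iter = functional_equation_iterate[OF d2 b2 K]
  have "\<exists>k>g. hankel_det c k \<noteq> 0" for g
    using hank[of "Suc g"] strict_mono_imp_increasing[OF n_mono, of "Suc g"]
    by (intro exI[of _ "n (Suc g)"]) simp
  then have trans: "\<not> algebraic (\<xi> 0)"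
    by (rule mahler_transcendental[OF d2 b2 F _ \<xi>F iter])
  have approx: "\<forall>\<^sub>F m in sequentially. \<exists>q p :: int. q > 0 \<and> of_int q \<le> (real b ^ d ^ m) ^ (n i + K + 1) \<and>
      1 \<le> \<bar>of_int q * \<xi> 0 - of_int p\<bar> * (real b ^ d ^ m) ^ n (Suc i) \<and>
      \<bar>of_int q * \<xi> 0 - of_int p\<bar> * (real b ^ d ^ m) ^ n i \<le> (real b ^ d ^ m) ^ (K + 1)" for i
    using strict_monoD[OF n_mono, of i "Suc i"]
    by (intro pade_approximations[OF d2 b2 F \<xi>F iter hank hank]) simp
  note exponent = approximations_imp_exponent_le[OF d2 b2 n_mono n_pos lims approx]
  \<comment> \<open>Since rho is at least 1, replacing it by its square only enlarges the
    minimum.\<close>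
  have "min \<rho> (real d) \<le> min (\<rho>\<^sup>2) (real d)"
    using self_le_power[of \<rho> 2] exponent(1) by (intro min.mono) auto
  then have "(1 + \<rho>) * min \<rho> (real d) \<le> (1 + \<rho>) * min (\<rho>\<^sup>2) (real d)"
    using exponent(1) by (intro mult_left_mono) auto
  then have upper: "irrationality_exponent (\<xi> 0) \<le> ereal ((1 + \<rho>) * min (\<rho>\<^sup>2) (real d))"
    using exponent(2) by (meson ereal_less_eq(3) order_trans)
  \<comment> \<open>For rho = 1 the minimum is 1 and the upper bound becomes 2; irrationality gives
    the reverse inequality.\<close>
  moreover have "irrationality_exponent (\<xi> 0) = 2" if "\<rho> = 1"
  proof (rule antisym)
    show "irrationality_exponent (\<xi> 0) \<le> 2" using upper that d2 by (simp add: min_def)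
    show "2 \<le> irrationality_exponent (\<xi> 0)"
      by (rule irrationality_exponent_ge_2[OF not_algebraic_imp_irrational[OF trans]])
  qed
  ultimately show ?thesis using trans unfolding \<xi>0 by blast
qed

end
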